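(* Let $A\subset\mathbb{R}^n$ be a bounded closed set with $0\in A\subset B_1$, and let $\Omega:=\mathbb{R}^n\setminus A$. Given any $g\in C(\partial\Omega)$, the following hold. (i) For any $\lambda\in\mathbb{R}$, there exists an infinity harmonic function $u$ in $\Omega$, $u\in C(\overline{\Omega})$, satisfying $u|_{\partial\Omega}=g$ and such that $u(x)-\lambda|x|$ attains its maximum and minimum (over $\overline{\Omega}$) on $\partial\Omega$. In the case $\lambda=0$ such $u$ is unique. (ii) For any $a\in\mathbb{R}^n$ with $|a|>0$, there exists an infinity harmonic function $u$ in $\Omega$, $u\in C(\overline{\Omega})$, satisfying $u|_{\partial\Omega}=g$ and such that $u(x)-a\cdot x$ attains its maximum and minimum (over $\overline{\Omega}$) on $\partial\Omega$.
   Context: $|\cdot|$ is the Euclidean norm and $B_1$ is the unit ball centered at $0$. An infinity harmonic function (IHF) in an open set $\Omega\subset\mathbb{R}^n$ is a function $u\in C(\Omega)$ that is a viscosity solution in $\Omega$ of $\triangle_\infty u:=\sum_{i,j}u_{x_i}u_{x_j}u_{x_ix_j}=0$. *)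

theory Defs
  imports "HOL-Analysis.Analysis"
begin

definition partial :: "'n \<Rightarrow> (real ^ 'n \<Rightarrow> real) \<Rightarrow> real ^ 'n \<Rightarrow> real"
  where "partial i f x = frechet_derivative f (at x) (axis i 1)"

text \<open>The two-sided derivative \<open>at x\<close> is used throughout, so the following two
  predicates are meant for open sets \<open>S\<close>.\<close>

definition C1_on :: "(real ^ 'n) set \<Rightarrow> (real ^ 'n \<Rightarrow> real) \<Rightarrow> bool"
  where "C1_on S f \<longleftrightarrow>
    (\<forall>x\<in>S. f differentiable (at x)) \<and> (\<forall>i. continuous_on S (partial i f))"

definition C2_on :: "(real ^ 'n) set \<Rightarrow> (real ^ 'n \<Rightarrow> real) \<Rightarrow> bool"
  where "C2_on S f \<longleftrightarrow> C1_on S f \<and> (\<forall>i. C1_on S (partial i f))"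

definition inf_laplacian :: "(real ^ 'n \<Rightarrow> real) \<Rightarrow> real ^ 'n \<Rightarrow> real"
  where "inf_laplacian f x =
    (\<Sum>i\<in>UNIV. \<Sum>j\<in>UNIV. partial i f x * partial j f x * partial j (partial i f) x)"

definition viscosity_subsolution :: "(real ^ 'n) set \<Rightarrow> (real ^ 'n \<Rightarrow> real) \<Rightarrow> bool"
  where "viscosity_subsolution S u \<longleftrightarrow>
    (\<forall>\<phi>. \<forall>x\<in>S. C2_on S \<phi> \<longrightarrow> (\<forall>\<^sub>F y in nhds x. u y - \<phi> y \<le> u x - \<phi> x)
       \<longrightarrow> inf_laplacian \<phi> x \<ge> 0)"

definition viscosity_supersolution :: "(real ^ 'n) set \<Rightarrow> (real ^ 'n \<Rightarrow> real) \<Rightarrow> bool"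
  where "viscosity_supersolution S u \<longleftrightarrow>
    (\<forall>\<phi>. \<forall>x\<in>S. C2_on S \<phi> \<longrightarrow> (\<forall>\<^sub>F y in nhds x. u y - \<phi> y \<ge> u x - \<phi> x)
       \<longrightarrow> inf_laplacian \<phi> x \<le> 0)"

definition infinity_harmonic_on :: "(real ^ 'n) set \<Rightarrow> (real ^ 'n \<Rightarrow> real) \<Rightarrow> bool"
  where "infinity_harmonic_on S u \<longleftrightarrow>
    continuous_on S u \<and> viscosity_subsolution S u \<and> viscosity_supersolution S u"

text \<open>Functions on \<open>closure S\<close> are total functions whose values off \<open>closure S\<close> are irrelevant.\<close>

definition dirichlet_solution ::
    "(real ^ 'n) set \<Rightarrow> (real ^ 'n \<Rightarrow> real) \<Rightarrow> (real ^ 'n \<Rightarrow> real) \<Rightarrow> bool"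
  where "dirichlet_solution S g u \<longleftrightarrow>
    infinity_harmonic_on S u \<and> continuous_on (closure S) u \<and> (\<forall>x\<in>frontier S. u x = g x)"

definition extrema_on_frontier :: "(real ^ 'n) set \<Rightarrow> (real ^ 'n \<Rightarrow> real) \<Rightarrow> bool"
  where "extrema_on_frontier S f \<longleftrightarrow>
    (\<exists>y\<in>frontier S. \<forall>x\<in>closure S. f x \<le> f y) \<and>
    (\<exists>y\<in>frontier S. \<forall>x\<in>closure S. f y \<le> f x)"

end

theory Submission imports Defs begin

text \<open>
  Everything rests on comparison with cones (Crandall, Evans and Gariepy): infinity subharmonic
  functions are the continuous functions that stay below a cone function \<open>a + b * dist y z\<close> in an open set not containing
  the vertex \<open>z\<close> if they do so on its frontier. Cones compare with each other by an elementary argument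
  along rays (\<open>steep_comparison\<close>), which also covers \<open>c * norm x\<close>, a cone with vertex \<open>0 \<in> A\<close>, and
  \<open>a \<bullet> x\<close>, a cone with vertex at infinity.

  Existence is Perron's method in terms of cones (\<open>perron\<close>, \<open>cone_dirichlet_problem\<close>). With \<open>\<psi>\<close> one of
  the two functions just mentioned and \<open>m\<close>, \<open>M\<close> the extreme values of \<open>g - \<psi>\<close> on the frontier, the
  solution is kept between \<open>\<psi> + m\<close> and \<open>\<psi> + M\<close>, which is exactly the condition on the extrema of
  \<open>u - \<psi>\<close>; steep cones with vertices on the frontier enforce the boundary values. That comparison
  with cones implies the viscosity inequality follows from the shape of the Hessian of a cone
  (\<open>comparison_imp_viscosity_subsolution\<close>).

  Uniqueness for \<open>c = 0\<close> is a comparison principle for bounded solutions in the exterior of a compact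
  set. Viscosity subsolutions satisfy the cone estimate on balls
  (\<open>viscosity_subsolution_cone_estimate\<close>), hence, following Armstrong and Smart, their suprema over
  \<open>\<epsilon>\<close>-balls are subsolutions of a finite difference equation (\<open>ball_sup_balanced\<close>). In a bounded domain
  one would now look at a maximum point of the difference; here the supremum may be
  approached only at infinity. The remedy is the idea of Crandall, Gunnarsson and Wang to
  modify the subsolution so that its slope is at least some \<open>\<delta> > 0\<close> everywhere (\<open>steepening\<close>). Going
  uphill from an almost maximal point of the difference one stays almost maximal, while the bounded
  subsolution gains a fixed amount in each step, which is absurd
  (\<open>strict_discrete_comparison\<close>).
\<close>

section \<open>Partial derivatives and second order expansion\<close>

lemma partial_eq_derivative:
  assumes "(f has_derivative f') (at x)"
  shows "partial i f x = f' (axis i 1)"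
  using frechet_derivative_at[OF assms] by (simp add: partial_def)

lemma has_derivative_partials:
  fixes f :: "real ^ 'n \<Rightarrow> real"
  assumes "f differentiable (at x)"
  shows "(f has_derivative (\<lambda>h. \<Sum>i\<in>UNIV. h $ i * partial i f x)) (at x)"
proof -
  let ?D = "frechet_derivative f (at x)"
  have D: "(f has_derivative ?D) (at x)"
    using assms frechet_derivative_works by blast
  interpret bounded_linear ?D using D by (rule has_derivative_bounded_linear)
  have "?D h = (\<Sum>i\<in>UNIV. h $ i * partial i f x)" for h
  proof -
    have "?D h = ?D (\<Sum>i\<in>UNIV. h $ i *\<^sub>R axis i 1)"
      using basis_expansion[of h] by (simp add: scalar_mult_eq_scaleR)
    then show ?thesis by (simp add: sum scaleR partial_def)
  qed
  then have "?D = (\<lambda>h. \<Sum>i\<in>UNIV. h $ i * partial i f x)" by (rule ext)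
  then show ?thesis using D by simp
qed

lemma C2_onD:
  assumes "C2_on S \<phi>" "x \<in> S"
  shows "\<phi> differentiable (at x)" "partial i \<phi> differentiable (at x)"
  using assms by (auto simp: C2_on_def C1_on_def)

lemma partial_uminus:
  assumes "f differentiable (at x)"
  shows "partial i (\<lambda>y. - f y) x = - partial i f x"
  using partial_eq_derivative[OF has_derivative_minus[OF has_derivative_partials[OF assms]]]
    partial_eq_derivative[OF has_derivative_partials[OF assms]] by metis

lemma partial_cong_open:
  assumes "open S" "x \<in> S" "\<And>y. y \<in> S \<Longrightarrow> f y = h y" "h differentiable (at x)"
  shows "f differentiable (at x)" "partial i f x = partial i h x"
proof -
  have "(f has_derivative frechet_derivative h (at x)) (at x)"
    using has_derivative_transform_within_open[OF _ assms(1,2), of h _ UNIV f] assms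
      frechet_derivative_works by metis
  then show "f differentiable (at x)" "partial i f x = partial i h x"
    using partial_eq_derivative by (auto simp: differentiable_def partial_def)
qed

lemma C1_on_cong:
  assumes "open S" "C1_on S h" "\<And>y. y \<in> S \<Longrightarrow> f y = h y"
  shows "C1_on S f"
proof -
  have "f differentiable (at x)" "partial i f x = partial i h x" if "x \<in> S" for x i
    using partial_cong_open[OF assms(1) that assms(3)] assms(2) that by (auto simp: C1_on_def)
  moreover from this have "continuous_on S (partial i f)" for i
    using assms(2) continuous_on_cong[of S S "partial i f" "partial i h"]
    by (auto simp: C1_on_def)
  ultimately show ?thesis by (auto simp: C1_on_def)
qed

lemma C1_on_uminus:
  assumes "C1_on S f"
  shows "C1_on S (\<lambda>y. - f y)"
proof -
  have "continuous_on S (partial i (\<lambda>y. - f y))" for i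
  proof -
    have "continuous_on S (\<lambda>x. - partial i f x)"
      using assms by (intro continuous_intros) (auto simp: C1_on_def)
    then show ?thesis
      by (rule continuous_on_eq) (use assms in \<open>auto simp: C1_on_def partial_uminus\<close>)
  qed
  then show ?thesis using assms by (auto simp: C1_on_def intro: differentiable_minus)
qed

lemma C2_on_uminus:
  assumes "open S" "C2_on S \<phi>"
  shows "C2_on S (\<lambda>y. - \<phi> y)"
proof -
  have "C1_on S (partial i (\<lambda>y. - \<phi> y))" for i
    by (rule C1_on_cong[OF assms(1), where h = "\<lambda>y. - partial i \<phi> y"])
      (use assms C1_on_uminus[of S "partial i \<phi>"] in
        \<open>auto simp: C2_on_def C1_on_def[of S \<phi>] partial_uminus\<close>)
  then show ?thesis using assms C1_on_uminus by (auto simp: C2_on_def)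
qed

lemma inf_laplacian_uminus:
  assumes "open S" "C2_on S \<phi>" "x \<in> S"
  shows "inf_laplacian (\<lambda>y. - \<phi> y) x = - inf_laplacian \<phi> x"
proof -
  have 1: "partial i (\<lambda>y. - \<phi> y) y = - partial i \<phi> y" if "y \<in> S" for i y
    using C2_onD[OF assms(2) that] by (intro partial_uminus)
  have 2: "partial j (partial i (\<lambda>y. - \<phi> y)) x = - partial j (partial i \<phi>) x" for i j
    using partial_cong_open(2)[OF assms(1,3) 1] C2_onD(2)[OF assms(2,3)]
    by (simp add: partial_uminus differentiable_minus)
  show ?thesis
    using 1 assms by (simp add: inf_laplacian_def 2 sum_negf)
qed

lemma viscosity_supersolution_iff_uminus:
  assumes "open S"
  shows "viscosity_supersolution S u \<longleftrightarrow> viscosity_subsolution S (\<lambda>x. - u x)"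
proof
  assume L: "viscosity_supersolution S u"
  show "viscosity_subsolution S (\<lambda>x. - u x)"
    unfolding viscosity_subsolution_def
  proof (intro allI ballI impI)
    fix \<phi> x assume x: "x \<in> S" "C2_on S \<phi>"
      and "\<forall>\<^sub>F y in nhds x. - u y - \<phi> y \<le> - u x - \<phi> x"
    then have "\<forall>\<^sub>F y in nhds x. u y - (- \<phi> y) \<ge> u x - (- \<phi> x)"
      by (elim eventually_mono) simp
    then have "inf_laplacian (\<lambda>y. - \<phi> y) x \<le> 0"
      using L x C2_on_uminus[OF assms x(2)] unfolding viscosity_supersolution_def by blast
    then show "0 \<le> inf_laplacian \<phi> x"
      using inf_laplacian_uminus[OF assms x(2,1)] by simp
  qed
next
  assume L: "viscosity_subsolution S (\<lambda>x. - u x)"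
  show "viscosity_supersolution S u"
    unfolding viscosity_supersolution_def
  proof (intro allI ballI impI)
    fix \<phi> x assume x: "x \<in> S" "C2_on S \<phi>"
      and "\<forall>\<^sub>F y in nhds x. u y - \<phi> y \<ge> u x - \<phi> x"
    then have "\<forall>\<^sub>F y in nhds x. - u y - (- \<phi> y) \<le> - u x - (- \<phi> x)"
      by (elim eventually_mono) simp
    then have "inf_laplacian (\<lambda>y. - \<phi> y) x \<ge> 0"
      using L x C2_on_uminus[OF assms x(2)] unfolding viscosity_subsolution_def by blast
    then show "inf_laplacian \<phi> x \<le> 0"
      using inf_laplacian_uminus[OF assms x(2,1)] by simp
  qed
qed

text \<open>Second order expansion along the segment from \<open>x\<close> to \<open>x + \<xi>\<close>: the derivative of the
  error is controlled by the differentiability of the first partial derivatives at \<open>x\<close> alone, and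
  the mean value theorem transfers the bound to the error.\<close>

lemma C2_taylor_upper:
  fixes \<phi> :: "real ^ 'n \<Rightarrow> real"
  assumes "open S" "C2_on S \<phi>" "x \<in> S" "\<eta> > 0"
  shows "\<exists>r>0. \<forall>\<xi>. norm \<xi> < r \<longrightarrow> \<phi> (x + \<xi>) \<le> \<phi> x + (\<Sum>i\<in>UNIV. \<xi> $ i * partial i \<phi> x)
     + (\<Sum>i\<in>UNIV. \<Sum>j\<in>UNIV. \<xi> $ i * (\<xi> $ j * partial j (partial i \<phi>) x)) / 2 + \<eta> * (norm \<xi>)\<^sup>2"
proof -
  define N where "N = real CARD('n)"
  have N: "N > 0" by (simp add: N_def)
  define H where "H i \<xi> = (\<Sum>j\<in>UNIV. \<xi> $ j * partial j (partial i \<phi>) x)" for i and \<xi> :: "real ^ 'n"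
  have "\<exists>d>0. \<forall>y. norm (y - x) < d \<longrightarrow>
      norm (partial i \<phi> y - partial i \<phi> x - H i (y - x)) \<le> (\<eta> / N) * norm (y - x)" for i
    using has_derivative_partials[OF C2_onD(2)[OF assms(2,3)], of i] assms(4) N
    unfolding has_derivative_at_alt H_def by (meson divide_pos_pos)
  then obtain d where d: "\<And>i. d i > 0" "\<And>i y. norm (y - x) < d i \<Longrightarrow>
      norm (partial i \<phi> y - partial i \<phi> x - H i (y - x)) \<le> (\<eta> / N) * norm (y - x)"
    by metis
  obtain \<rho> where \<rho>: "\<rho> > 0" "ball x \<rho> \<subseteq> S"
    using assms open_contains_ball by blast
  define r where "r = min \<rho> (Min (range d))"
  have "Min (range d) > 0" using d(1) by simp
  then have r: "r > 0" "r \<le> \<rho>" "\<And>i. r \<le> d i"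
    using \<rho> by (auto simp: r_def intro!: min.coboundedI2)
  have "\<phi> (x + \<xi>) \<le> \<phi> x + (\<Sum>i\<in>UNIV. \<xi> $ i * partial i \<phi> x)
     + (\<Sum>i\<in>UNIV. \<xi> $ i * H i \<xi>) / 2 + \<eta> * (norm \<xi>)\<^sup>2" if \<xi>: "norm \<xi> < r" for \<xi>
  proof -
    define p where "p = (\<Sum>i\<in>UNIV. \<xi> $ i * partial i \<phi> x)"
    define q where "q = (\<Sum>i\<in>UNIV. \<xi> $ i * H i \<xi>)"
    define G where "G t = \<phi> (x + t *\<^sub>R \<xi>) - t * p - t\<^sup>2 / 2 * q" for t :: real
    define G' where "G' t = (\<Sum>i\<in>UNIV. \<xi> $ i * partial i \<phi> (x + t *\<^sub>R \<xi>)) - p - t * q" for t :: real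
    have small: "norm (t *\<^sub>R \<xi>) < r" if "0 \<le> t" "t \<le> 1" for t
      using \<xi> that by (simp add: mult_left_le_one_le[THEN le_less_trans])
    have der: "(G has_real_derivative G' t) (at t)" if "0 \<le> t" "t \<le> 1" for t
    proof -
      have "x + t *\<^sub>R \<xi> \<in> S"
        using small[OF that] r \<rho> by (auto simp: dist_norm)
      then have D: "(\<phi> has_derivative (\<lambda>h. \<Sum>i\<in>UNIV. h $ i * partial i \<phi> (x + t *\<^sub>R \<xi>))) (at (x + t *\<^sub>R \<xi>))"
        by (intro has_derivative_partials C2_onD(1)[OF assms(2)])
      have "((\<lambda>t. \<phi> (x + t *\<^sub>R \<xi>)) has_derivative
          (\<lambda>s. \<Sum>i\<in>UNIV. (s *\<^sub>R \<xi>) $ i * partial i \<phi> (x + t *\<^sub>R \<xi>))) (at t)"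
        by (rule has_derivative_compose[where f = "\<lambda>t. x + t *\<^sub>R \<xi>", OF _ D]) (auto intro!: derivative_eq_intros)
      then have "((\<lambda>t. \<phi> (x + t *\<^sub>R \<xi>)) has_real_derivative
          (\<Sum>i\<in>UNIV. \<xi> $ i * partial i \<phi> (x + t *\<^sub>R \<xi>))) (at t)"
        unfolding has_field_derivative_def
        by (rule has_derivative_eq_rhs) (simp add: fun_eq_iff sum_distrib_left sum_distrib_right mult_ac)
      then show ?thesis unfolding G_def G'_def
        by (auto intro!: derivative_eq_intros)
    qed
    have "\<exists>t>0. t < 1 \<and> G 1 - G 0 = (1 - 0) * G' t"
      by (rule MVT2) (use der in auto)
    then obtain t where t: "0 < t" "t < 1" "G 1 - G 0 = G' t" by auto
    have Hlin: "H i (t *\<^sub>R \<xi>) = t * H i \<xi>" for i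
      by (simp add: H_def sum_distrib_left mult_ac)
    have "G' t = (\<Sum>i\<in>UNIV. \<xi> $ i * (partial i \<phi> (x + t *\<^sub>R \<xi>) - partial i \<phi> x - H i (t *\<^sub>R \<xi>)))"
      unfolding G'_def p_def q_def Hlin
      by (simp add: algebra_simps sum_subtractf sum_distrib_left sum.distrib)
    also have "\<dots> \<le> (\<Sum>i\<in>(UNIV::'n set). norm \<xi> * ((\<eta> / N) * norm \<xi>))"
    proof (rule sum_mono)
      fix i :: 'n
      have "\<bar>partial i \<phi> (x + t *\<^sub>R \<xi>) - partial i \<phi> x - H i (t *\<^sub>R \<xi>)\<bar> \<le> (\<eta> / N) * norm (t *\<^sub>R \<xi>)"
        using d(2)[where i = i and y = "x + t *\<^sub>R \<xi>"] small[of t] t r(3)[of i] by auto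
      also have "\<dots> \<le> (\<eta> / N) * norm \<xi>"
        using t N assms(4) by (intro mult_left_mono) (auto simp: mult_left_le_one_le)
      finally have "\<bar>\<xi> $ i\<bar> * \<bar>partial i \<phi> (x + t *\<^sub>R \<xi>) - partial i \<phi> x - H i (t *\<^sub>R \<xi>)\<bar>
          \<le> norm \<xi> * ((\<eta> / N) * norm \<xi>)"
        by (intro mult_mono) (auto simp: component_le_norm_cart)
      then show "\<xi> $ i * (partial i \<phi> (x + t *\<^sub>R \<xi>) - partial i \<phi> x - H i (t *\<^sub>R \<xi>))
          \<le> norm \<xi> * ((\<eta> / N) * norm \<xi>)"
        by (metis abs_le_D1 abs_mult)
    qed
    also have "\<dots> = \<eta> * (norm \<xi>)\<^sup>2"
      using N by (simp add: N_def power2_eq_square)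
    finally show ?thesis
      using t(3) by (simp add: G_def p_def q_def)
  qed
  then show ?thesis using r(1) by (auto simp: H_def sum_distrib_left)
qed

section \<open>Comparison with cones\<close>

text \<open>The vertex may lie anywhere outside \<open>V\<close>, also inside \<open>\<Omega>\<close>, and the
  slope \<open>b\<close> may have either sign. The property makes sense for arbitrary functions and passes to
  pointwise suprema, which is what Perron's method relies on.\<close>

definition comparison_cones_above :: "'a::euclidean_space set \<Rightarrow> ('a \<Rightarrow> real) \<Rightarrow> bool"
  where "comparison_cones_above \<Omega> u \<longleftrightarrow>
    (\<forall>V z a b. open V \<and> bounded V \<and> closure V \<subseteq> \<Omega> \<and> z \<notin> V \<and>
       (\<forall>y\<in>frontier V. u y \<le> a + b * dist y z) \<longrightarrow> (\<forall>y\<in>V. u y \<le> a + b * dist y z))"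

definition comparison_cones_below :: "'a::euclidean_space set \<Rightarrow> ('a \<Rightarrow> real) \<Rightarrow> bool"
  where "comparison_cones_below \<Omega> u \<longleftrightarrow> comparison_cones_above \<Omega> (\<lambda>x. - u x)"

lemma comparison_cones_aboveD:
  assumes "comparison_cones_above \<Omega> u" "open V" "bounded V" "closure V \<subseteq> \<Omega>" "z \<notin> V"
    "\<And>y. y \<in> frontier V \<Longrightarrow> u y \<le> a + b * dist y z" "y \<in> V"
  shows "u y \<le> a + b * dist y z"
  using assms unfolding comparison_cones_above_def by blast

lemma comparison_cones_belowD:
  assumes "comparison_cones_below \<Omega> u" "open V" "bounded V" "closure V \<subseteq> \<Omega>" "z \<notin> V"
    "\<And>y. y \<in> frontier V \<Longrightarrow> a + b * dist y z \<le> u y" "y \<in> V"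
  shows "a + b * dist y z \<le> u y"
proof -
  have "- u y \<le> - a + (- b) * dist y z"
    by (rule comparison_cones_aboveD[OF assms(1)[unfolded comparison_cones_below_def] assms(2-5)])
      (use assms(6,7) in \<open>auto dest!: assms(6)\<close>)
  then show ?thesis by simp
qed

lemma comparison_cones_belowI:
  assumes "\<And>V z a b y. \<lbrakk>open V; bounded V; closure V \<subseteq> \<Omega>; z \<notin> V;
      \<And>y. y \<in> frontier V \<Longrightarrow> a + b * dist y z \<le> u y; y \<in> V\<rbrakk> \<Longrightarrow> a + b * dist y z \<le> u y"
  shows "comparison_cones_below \<Omega> u"
  unfolding comparison_cones_below_def comparison_cones_above_def
proof (intro allI impI ballI, elim conjE)
  fix V z a b y
  assume *: "open V" "bounded V" "closure V \<subseteq> \<Omega>" "z \<notin> V" "y \<in> V"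
    and le: "\<forall>y\<in>frontier V. - u y \<le> a + b * dist y z"
  have "(- a) + (- b) * dist y z \<le> u y"
    by (rule assms[OF *(1-4) _ *(5)]) (use le in force)
  then show "- u y \<le> a + b * dist y z" by simp
qed

text \<open>An abstraction of the functions \<open>f\<close> with \<open>\<bar>\<nabla>f\<bar> = b\<close> whose gradient lines
  are straight: from each point of \<open>V\<close> the frontier can be reached both uphill and downhill at the
  full slope \<open>b\<close> that the Lipschitz bound allows. Cones with vertex outside \<open>V\<close> and linear functions
  are of this kind, and these are all the explicit solutions that serve as barriers.\<close>

definition steep_on :: "'a::euclidean_space set \<Rightarrow> real \<Rightarrow> ('a \<Rightarrow> real) \<Rightarrow> bool"
  where "steep_on V b f \<longleftrightarrow> (\<forall>x y. \<bar>f x - f y\<bar> \<le> b * dist x y) \<and>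
    (\<forall>x\<in>V. (\<exists>y\<in>frontier V. f y \<ge> f x + b * dist x y) \<and> (\<exists>y\<in>frontier V. f y \<le> f x - b * dist x y))"

text \<open>The steeper of the two functions decides the direction. If it is \<open>f\<close>, walk uphill
  along \<open>f\<close> to the frontier: \<open>h\<close> cannot grow faster, so \<open>f - h\<close> does not decrease on the way. If it
  is \<open>h\<close>, walk downhill along \<open>h\<close>.\<close>

lemma steep_comparison:
  assumes "steep_on V b f" "steep_on V c h" "\<And>y. y \<in> frontier V \<Longrightarrow> f y \<le> h y" "x \<in> V"
  shows "f x \<le> h x"
proof (cases "c \<le> b")
  case True
  obtain y where y: "y \<in> frontier V" "f y \<ge> f x + b * dist x y"
    using assms unfolding steep_on_def by blast
  have "\<bar>h x - h y\<bar> \<le> c * dist x y" using assms unfolding steep_on_def by blast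
  moreover have "c * dist x y \<le> b * dist x y" using True by (simp add: mult_right_mono)
  ultimately show ?thesis using y assms(3)[of y] by linarith
next
  case False
  obtain y where y: "y \<in> frontier V" "h y \<le> h x - c * dist x y"
    using assms unfolding steep_on_def by blast
  have "\<bar>f x - f y\<bar> \<le> b * dist x y" using assms unfolding steep_on_def by blast
  moreover have "b * dist x y \<le> c * dist x y" using False by (simp add: mult_right_mono)
  ultimately show ?thesis using y assms(3)[of y] by linarith
qed

lemma steep_on_lipschitz:
  fixes f :: "'a::euclidean_space \<Rightarrow> real"
  assumes "steep_on V b f"
  shows "0 \<le> b" "\<bar>f x - f y\<bar> \<le> b * dist x y" "continuous_on S f"
proof -
  have lip: "\<bar>f x - f y\<bar> \<le> b * dist x y" for x y
    using assms by (simp add: steep_on_def)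
  obtain e :: 'a where "e \<in> Basis" using nonempty_Basis by blast
  then show b: "0 \<le> b" using lip[of e 0] by (simp add: order_trans[OF abs_ge_zero])
  show "\<bar>f x - f y\<bar> \<le> b * dist x y" by (rule lip)
  show "continuous_on S f"
    using lip b by (intro lipschitz_on_continuous_on[of b] lipschitz_onI) (auto simp: dist_real_def)
qed

lemma ray_meets_frontier:
  fixes x :: "'a::euclidean_space"
  assumes "open V" "bounded V" "x \<in> V" "e \<noteq> 0"
  obtains t where "t > 0" "x + t *\<^sub>R e \<in> frontier V"
  using ray_to_frontier[of V x e] assms by (metis interior_open)

lemma steep_uminus: "steep_on V b f \<Longrightarrow> steep_on V b (\<lambda>x. - f x)"
  unfolding steep_on_def by (auto simp: abs_minus_commute) (force+)

lemma steep_add_const: "steep_on V b f \<Longrightarrow> steep_on V b (\<lambda>x. f x + k)"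
  unfolding steep_on_def by (auto simp: add_ac diff_add_eq)

text \<open>The ray from \<open>z\<close> through \<open>x\<close> leads uphill to the frontier; the segment from \<open>x\<close> back
  to \<open>z\<close> leads downhill, and it has to leave \<open>V\<close> because \<open>z\<close> is not in \<open>V\<close>.\<close>

lemma dist_steep:
  fixes V :: "'a::euclidean_space set"
  assumes "open V" "bounded V" "z \<notin> V"
  shows "steep_on V 1 (\<lambda>y. dist y z)"
  unfolding steep_on_def
proof (intro conjI allI ballI)
  show "\<bar>dist x z - dist y z\<bar> \<le> 1 * dist x y" for x y
    using abs_dist_diff_le[of x z y] by (simp add: dist_commute)
  fix x assume x: "x \<in> V"
  then have "x - z \<noteq> 0" using assms by auto
  then obtain t where t: "t > 0" "x + t *\<^sub>R (x - z) \<in> frontier V"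
    using ray_meets_frontier assms x by metis
  have "x + t *\<^sub>R (x - z) - z = (1 + t) *\<^sub>R (x - z)" by (simp add: algebra_simps)
  then have "dist (x + t *\<^sub>R (x - z)) z = (1 + t) * dist x z"
    using t(1) by (simp add: dist_norm)
  moreover have "dist x (x + t *\<^sub>R (x - z)) = t * dist x z"
    using t(1) by (simp add: dist_norm)
  ultimately show "\<exists>y\<in>frontier V. dist x z + 1 * dist x y \<le> dist y z"
    using t(2) by (intro bexI[OF _ t(2)]) (simp add: algebra_simps)
  have "closed_segment x z \<inter> frontier V \<noteq> {}"
    using x assms(3) by (intro connected_Int_frontier) auto
  then obtain y where y: "y \<in> closed_segment x z" "y \<in> frontier V" by blast
  then have "between (x, z) y" by (simp add: between_mem_segment)
  then have "dist x z = dist x y + dist y z" by (simp add: between)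
  then show "\<exists>y\<in>frontier V. dist y z \<le> dist x z - 1 * dist x y"
    using y(2) by force
qed

lemma steep_scale:
  assumes "steep_on V b f"
  shows "steep_on V (\<bar>c\<bar> * b) (\<lambda>x. c * f x)"
proof -
  have pos: "steep_on V (c * b) (\<lambda>x. c * f x)" if f: "steep_on V b f" and c: "c \<ge> 0" for c f
    unfolding steep_on_def
  proof (intro conjI allI ballI)
    show "\<bar>c * f x - c * f y\<bar> \<le> c * b * dist x y" for x y
      using mult_left_mono[of "\<bar>f x - f y\<bar>" "b * dist x y" c] f c
      unfolding steep_on_def by (simp add: abs_mult right_diff_distrib[symmetric] mult_ac)
    fix x assume x: "x \<in> V"
    from f x obtain y where "y \<in> frontier V" "f y \<ge> f x + b * dist x y"
      unfolding steep_on_def by blast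
    then show "\<exists>y\<in>frontier V. c * f x + c * b * dist x y \<le> c * f y"
      using mult_left_mono[of "f x + b * dist x y" "f y" c] c by (auto simp: algebra_simps)
    from f x obtain y where "y \<in> frontier V" "f y \<le> f x - b * dist x y"
      unfolding steep_on_def by blast
    then show "\<exists>y\<in>frontier V. c * f y \<le> c * f x - c * b * dist x y"
      using mult_left_mono[of "f y" "f x - b * dist x y" c] c by (auto simp: algebra_simps)
  qed
  show ?thesis
  proof (cases "c \<ge> 0")
    case True then show ?thesis using pos[OF assms] by simp
  next
    case False
    then show ?thesis using pos[OF steep_uminus[OF assms], of "- c"] by simp
  qed
qed

lemma cone_steep:
  fixes V :: "'a::euclidean_space set"
  assumes "open V" "bounded V" "z \<notin> V"
  shows "steep_on V \<bar>b\<bar> (\<lambda>y. a + b * dist y z)"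
  using steep_add_const[OF steep_scale[OF dist_steep[OF assms], of b], of a] by (simp add: add.commute)

lemma linear_steep:
  fixes a :: "'a::euclidean_space"
  assumes "open V" "bounded V" "a \<noteq> 0"
  shows "steep_on V (norm a) (\<lambda>x. a \<bullet> x)"
  unfolding steep_on_def
proof (intro conjI allI ballI)
  show "\<bar>a \<bullet> x - a \<bullet> y\<bar> \<le> norm a * dist x y" for x y
    using Cauchy_Schwarz_ineq2[of a "x - y"] by (simp add: inner_diff_right dist_norm)
  fix x assume x: "x \<in> V"
  obtain t where t: "t > 0" "x + t *\<^sub>R a \<in> frontier V"
    using ray_meets_frontier assms x by metis
  then show "\<exists>y\<in>frontier V. a \<bullet> x + norm a * dist x y \<le> a \<bullet> y"
    by (intro bexI[OF _ t(2)])
      (simp add: inner_add_right dist_norm power2_norm_eq_inner[symmetric] power2_eq_square)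
  obtain t where t: "t > 0" "x + t *\<^sub>R (- a) \<in> frontier V"
    using ray_meets_frontier[OF assms(1,2) x, of "- a"] assms(3) by auto
  then show "\<exists>y\<in>frontier V. a \<bullet> y \<le> a \<bullet> x - norm a * dist x y"
    by (intro bexI[OF _ t(2)])
      (simp add: inner_diff_right dist_norm power2_norm_eq_inner[symmetric] power2_eq_square)
qed

lemma steep_imp_comparison:
  assumes "\<And>V. \<lbrakk>open V; bounded V; closure V \<subseteq> \<Omega>\<rbrakk> \<Longrightarrow> steep_on V b f"
  shows "comparison_cones_above \<Omega> f" "comparison_cones_below \<Omega> f"
proof -
  show "comparison_cones_above \<Omega> f"
    unfolding comparison_cones_above_def
  proof (intro allI impI ballI)
    fix V z a c y
    assume V: "open V \<and> bounded V \<and> closure V \<subseteq> \<Omega> \<and> z \<notin> V \<and> (\<forall>y\<in>frontier V. f y \<le> a + c * dist y z)"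
      and y: "y \<in> V"
    show "f y \<le> a + c * dist y z"
      by (rule steep_comparison[OF assms cone_steep]) (use V y in auto)
  qed
  show "comparison_cones_below \<Omega> f"
  proof (rule comparison_cones_belowI)
    fix V z a c y
    assume V: "open V" "bounded V" "closure V \<subseteq> \<Omega>" "z \<notin> V"
      "\<And>y. y \<in> frontier V \<Longrightarrow> a + c * dist y z \<le> f y" and y: "y \<in> V"
    show "a + c * dist y z \<le> f y"
      by (rule steep_comparison[OF cone_steep assms]) (use V y in auto)
  qed
qed

lemma cone_comparison:
  fixes z :: "'a::euclidean_space"
  assumes "z \<notin> \<Omega>"
  shows "comparison_cones_above \<Omega> (\<lambda>y. a + b * dist y z)"
    and "comparison_cones_below \<Omega> (\<lambda>y. a + b * dist y z)"
proof -
  have *: "steep_on V \<bar>b\<bar> (\<lambda>y. a + b * dist y z)"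
    if "open V" "bounded V" "closure V \<subseteq> \<Omega>" for V
    by (rule cone_steep) (use that assms closure_subset in auto)
  show "comparison_cones_above \<Omega> (\<lambda>y. a + b * dist y z)"
    "comparison_cones_below \<Omega> (\<lambda>y. a + b * dist y z)"
    by (rule steep_imp_comparison[OF *]; assumption)+
qed

text \<open>The cone with vertex \<open>x\<close> that has the value \<open>u x\<close> there and \<open>M\<close> on the sphere
  dominates \<open>u\<close> on the frontier of the punctured ball, hence inside. Thus a locally bounded function
  with this property is locally Lipschitz.\<close>

lemma comparison_cones_lipschitz:
  fixes u :: "'a::euclidean_space \<Rightarrow> real"
  assumes u: "comparison_cones_above \<Omega> u" and ball: "cball x R \<subseteq> \<Omega>" and R: "R > 0"
    and M: "\<And>y. y \<in> cball x R \<Longrightarrow> u y \<le> M" and y: "y \<in> cball x R"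
  shows "u y \<le> u x + (M - u x) / R * dist y x"
proof -
  have Mx: "u x \<le> M" using M R by auto
  let ?V = "ball x R - {x}"
  have fr: "frontier ?V \<subseteq> sphere x R \<union> {x}"
    using R by (auto simp: frontier_def interior_open open_delete dest!: subsetD[OF closure_mono[OF Diff_subset]])
  have *: "u w \<le> u x + (M - u x) / R * dist w x" if "w \<in> sphere x R \<union> {x}" for w
    using that M[of w] R by (auto simp: dist_commute)
  show ?thesis
  proof (cases "y \<in> ?V")
    case True
    show ?thesis
    proof (rule comparison_cones_aboveD[OF u])
      show "closure ?V \<subseteq> \<Omega>"
        using closure_mono[OF Diff_subset, of "ball x R" "{x}"] ball R by auto
      show "bounded ?V" using bounded_diff by blast
    qed (use True fr * in auto)
  next
    case False
    then show ?thesis using y by (intro *) (auto simp: dist_commute)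
  qed
qed

lemma comparison_cones_continuous:
  fixes u :: "'a::euclidean_space \<Rightarrow> real"
  assumes "open \<Omega>" and u: "comparison_cones_above \<Omega> u"
    and lo: "continuous_on \<Omega> lo" "\<And>x. x \<in> \<Omega> \<Longrightarrow> lo x \<le> u x"
    and hi: "continuous_on \<Omega> hi" "\<And>x. x \<in> \<Omega> \<Longrightarrow> u x \<le> hi x"
  shows "continuous_on \<Omega> u"
proof -
  have "continuous (at x) u" if x: "x \<in> \<Omega>" for x
  proof -
    obtain R where R: "R > 0" "cball x (2 * R) \<subseteq> \<Omega>"
    proof -
      obtain e where "e > 0" "cball x e \<subseteq> \<Omega>" using assms(1) x open_contains_cball by blast
      then show ?thesis using that[of "e/2"] by auto
    qed
    let ?B = "cball x (2 * R)"
    have "compact (lo ` ?B)" "compact (hi ` ?B)"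
      using compact_continuous_image[OF continuous_on_subset[OF lo(1) R(2)]]
        compact_continuous_image[OF continuous_on_subset[OF hi(1) R(2)]] by simp_all
    then obtain m M where m: "\<And>y. y \<in> ?B \<Longrightarrow> \<bar>lo y\<bar> \<le> m" and M: "\<And>y. y \<in> ?B \<Longrightarrow> \<bar>hi y\<bar> \<le> M"
      by (metis compact_imp_bounded bounded_iff imageI real_norm_def)
    have bd: "\<bar>u y\<bar> \<le> m + M" if "y \<in> ?B" for y
    proof -
      have "y \<in> \<Omega>" using that R by blast
      then show ?thesis using m[OF that] M[OF that] lo(2)[of y] hi(2)[of y] by linarith
    qed
    define L where "L = 2 * (m + M) / R"
    have half: "u w - u y \<le> L * dist w y" if "y \<in> cball x R" "w \<in> cball x R" "dist w y \<le> R" for y w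
    proof -
      have sub: "cball y R \<subseteq> ?B"
      proof
        fix v assume "v \<in> cball y R"
        then show "v \<in> ?B" using that dist_triangle[of x v y] by auto
      qed
      have "u w \<le> u y + ((m + M) - u y) / R * dist w y"
      proof (rule comparison_cones_lipschitz[OF u])
        show "cball y R \<subseteq> \<Omega>" using sub R by blast
        show "u v \<le> m + M" if "v \<in> cball y R" for v using bd[of v] that sub by auto
      qed (use R that in \<open>auto simp: dist_commute\<close>)
      also have "\<dots> \<le> u y + L * dist w y"
        using bd[of y] that R unfolding L_def
        by (intro add_left_mono mult_right_mono divide_right_mono) auto
      finally show ?thesis by simp
    qed
    have Lpos: "L \<ge> 0" using bd[of x] R unfolding L_def by auto
    have "\<forall>e>0. \<exists>d>0. \<forall>y. dist y x < d \<longrightarrow> dist (u y) (u x) < e"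
    proof (intro allI impI)
      fix e :: real assume "e > 0"
      have "dist (u y) (u x) < e" if "dist y x < min R (e / (L + 1))" for y
      proof -
        have "\<bar>u y - u x\<bar> \<le> L * dist y x"
          using half[of x y] half[of y x] that R by (auto simp: dist_commute abs_le_iff)
        also have "\<dots> \<le> (L + 1) * dist y x" by (simp add: mult_right_mono)
        also have "\<dots> < e" using that Lpos by (simp add: pos_less_divide_eq mult.commute)
        finally show ?thesis by (simp add: dist_real_def)
      qed
      then show "\<exists>d>0. \<forall>y. dist y x < d \<longrightarrow> dist (u y) (u x) < e"
        using \<open>e > 0\<close> Lpos R by (intro exI[of _ "min R (e / (L + 1))"]) auto
    qed
    then show ?thesis unfolding continuous_at_eps_delta by simp
  qed
  then show ?thesis by (simp add: continuous_at_imp_continuous_on)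
qed

section \<open>Perron's method\<close>

text \<open>Perron's method. The set \<open>\<U>\<close> consists of upper barriers, and \<open>u\<close> is the supremum of
  all functions below them that satisfy comparison with cones from above. This comparison is clear for
  \<open>u\<close>. For comparison from below, suppose that a cone \<open>C\<close> lies below \<open>u\<close> on the frontier of \<open>V\<close>
  but not in \<open>V\<close>. Then replacing \<open>u\<close> by \<open>max u C\<close> in \<open>V\<close> gives a larger competitor: it stays
  below the barriers because these compare with \<open>C\<close> from below, and it compares with cones from above
  because cones compare with each other. This contradicts the maximality of \<open>u\<close>.\<close>

theorem perron:
  fixes \<U> :: "('a::euclidean_space \<Rightarrow> real) set"
  assumes \<Omega>: "open \<Omega>"
    and U: "\<And>U. U \<in> \<U> \<Longrightarrow> comparison_cones_below \<Omega> U"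
    and lo: "comparison_cones_above \<Omega> lo" "continuous_on \<Omega> lo"
      "\<And>U x. \<lbrakk>U \<in> \<U>; x \<in> \<Omega>\<rbrakk> \<Longrightarrow> lo x \<le> U x"
    and hi: "hi \<in> \<U>" "continuous_on \<Omega> hi"
  obtains u where "comparison_cones_above \<Omega> u" "comparison_cones_below \<Omega> u" "continuous_on \<Omega> u"
    "\<And>U x. \<lbrakk>U \<in> \<U>; x \<in> \<Omega>\<rbrakk> \<Longrightarrow> u x \<le> U x"
    "\<And>h x. \<lbrakk>comparison_cones_above \<Omega> h; \<And>U x. \<lbrakk>U \<in> \<U>; x \<in> \<Omega>\<rbrakk> \<Longrightarrow> h x \<le> U x; x \<in> \<Omega>\<rbrakk> \<Longrightarrow> h x \<le> u x"
proof -
  define F where "F = {h. comparison_cones_above \<Omega> h \<and> (\<forall>U\<in>\<U>. \<forall>x\<in>\<Omega>. h x \<le> U x)}"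
  define u where "u x = (SUP h\<in>F. h x)" for x
  have loF: "lo \<in> F" using lo by (auto simp: F_def)
  have upper: "h x \<le> u x" if "h \<in> F" "x \<in> \<Omega>" for h x
    unfolding u_def using that hi(1)
    by (intro cSUP_upper) (auto simp: F_def intro!: bdd_aboveI[of _ "hi x"])
  have least: "u x \<le> k" if "\<And>h. h \<in> F \<Longrightarrow> h x \<le> k" for x k
    unfolding u_def using that loF by (intro cSUP_least) auto
  have below: "u x \<le> U x" if "U \<in> \<U>" "x \<in> \<Omega>" for U x
    using that by (intro least) (auto simp: F_def)
  have above: "comparison_cones_above \<Omega> u"
    unfolding comparison_cones_above_def
  proof (intro allI impI ballI, elim conjE)
    fix V z a b y
    assume V: "open V" "bounded V" "closure V \<subseteq> \<Omega>" "z \<notin> V" "\<forall>y\<in>frontier V. u y \<le> a + b * dist y z"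
      and y: "y \<in> V"
    show "u y \<le> a + b * dist y z"
    proof (rule least)
      fix h assume h: "h \<in> F"
      have "h w \<le> a + b * dist w z" if "w \<in> frontier V" for w
      proof -
        have "w \<in> \<Omega>" using V(3) that by (auto simp: frontier_def)
        then have "h w \<le> u w" by (rule upper[OF h])
        then show ?thesis using V(5) that by (meson order_trans)
      qed
      then show "h y \<le> a + b * dist y z"
        using h V(1-4) y comparison_cones_aboveD[of \<Omega> h V z a b y] by (auto simp: F_def)
    qed
  qed
  have cont: "continuous_on \<Omega> u"
    by (rule comparison_cones_continuous[OF \<Omega> above lo(2) _ hi(2)])
      (use upper[OF loF] below[OF hi(1)] in auto)
  have "comparison_cones_below \<Omega> u"
  proof (rule comparison_cones_belowI)
    fix V z a b x
    assume V: "open V" "bounded V" "closure V \<subseteq> \<Omega>" "z \<notin> V"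
      and fr: "\<And>y. y \<in> frontier V \<Longrightarrow> a + b * dist y z \<le> u y" and x: "x \<in> V"
    define C where "C y = a + b * dist y z" for y
    define v where "v y = (if y \<in> V then max (u y) (C y) else u y)" for y
    have V\<Omega>: "V \<subseteq> \<Omega>" using V closure_subset by blast
    have uv: "u y \<le> v y" for y by (simp add: v_def)
    have CU: "C y \<le> U y" if "y \<in> V" "U \<in> \<U>" for y U
      unfolding C_def
    proof (rule comparison_cones_belowD[OF U[OF that(2)] V _ that(1)])
      fix w assume w: "w \<in> frontier V"
      then have "w \<in> \<Omega>" using V by (auto simp: frontier_def)
      then show "a + b * dist w z \<le> U w" using fr[OF w] below[OF that(2), of w] by linarith
    qed
    have vU: "v y \<le> U y" if "y \<in> \<Omega>" "U \<in> \<U>" for y U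
      using that below CU by (auto simp: v_def)
    have "comparison_cones_above \<Omega> v"
      unfolding comparison_cones_above_def
    proof (intro allI impI ballI, elim conjE)
      fix W z' a' b' y
      assume W: "open W" "bounded W" "closure W \<subseteq> \<Omega>" "z' \<notin> W"
        and le: "\<forall>y\<in>frontier W. v y \<le> a' + b' * dist y z'" and y: "y \<in> W"
      have uW: "u w \<le> a' + b' * dist w z'" if "w \<in> W" for w
        by (rule comparison_cones_aboveD[OF above W _ that]) (use le uv order_trans in blast)
      then have uW': "u w \<le> a' + b' * dist w z'" if "w \<in> closure W" for w
      proof (cases "w \<in> W")
        case False
        then have "w \<in> frontier W" using that W(1) by (simp add: frontier_def interior_open)
        then show ?thesis using le uv[of w] by (meson order_trans)
      qed (rule uW)
      \<comment> \<open>the set where the bump is effective; on its frontier the cone agrees with or lies below \<open>u\<close>\<close>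
      let ?V' = "{w \<in> V. u w < C w}"
      have V': "open ?V'"
      proof -
        have "continuous_on V (\<lambda>w. C w - u w)"
          unfolding C_def by (intro continuous_intros continuous_on_subset[OF cont V\<Omega>])
        then have "open (V \<inter> (\<lambda>w. C w - u w) -` {0<..})"
          using V(1) continuous_on_open_vimage by (metis Int_commute open_greaterThan)
        moreover have "V \<inter> (\<lambda>w. C w - u w) -` {0<..} = ?V'" by auto
        ultimately show ?thesis by simp
      qed
      have "C y \<le> a' + b' * dist y z'" if "y \<in> ?V'"
      proof (rule steep_comparison[where V = "W \<inter> ?V'" and f = C and h = "\<lambda>y. a' + b' * dist y z'" and x = y])
        have "open (W \<inter> ?V')" "bounded (W \<inter> ?V')" using W V' by (auto intro: bounded_Int)
        then show "steep_on (W \<inter> ?V') \<bar>b\<bar> C" "steep_on (W \<inter> ?V') \<bar>b'\<bar> (\<lambda>y. a' + b' * dist y z')"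
          unfolding C_def using V W by (intro cone_steep; simp)+
        show "y \<in> W \<inter> ?V'" using y that by simp
        fix w assume w: "w \<in> frontier (W \<inter> ?V')"
        have wW: "w \<in> closure W" and wV: "w \<in> closure ?V'" and wn: "w \<notin> W \<inter> ?V'"
          using w W(1) V' closure_mono[of "W \<inter> ?V'" W] closure_mono[of "W \<inter> ?V'" ?V']
          by (auto simp: frontier_def interior_open open_Int)
        show "C w \<le> a' + b' * dist w z'"
        proof (cases "w \<in> ?V'")
          case True
          then have "w \<in> frontier W" using wn wW W(1) by (auto simp: frontier_def interior_open)
          then show ?thesis using le True by (auto simp: v_def)
        next
          case False
          have "w \<in> closure V" using wV closure_mono[of ?V' V] by blast
          have "C w \<le> u w"
          proof (cases "w \<in> V")
            case True then show ?thesis using False by auto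
          next
            case False
            then have "w \<in> frontier V"
              using \<open>w \<in> closure V\<close> V(1) by (simp add: frontier_def interior_open)
            then show ?thesis using fr by (simp add: C_def)
          qed
          then show ?thesis using uW'[OF wW] by linarith
        qed
      qed
      then show "v y \<le> a' + b' * dist y z'"
        using uW[OF y] by (cases "u y < C y"; cases "y \<in> V") (auto simp: v_def max_def)
    qed
    then have "v \<in> F" using vU by (auto simp: F_def)
    then have "v x \<le> u x" using upper x V\<Omega> by blast
    then show "a + b * dist x z \<le> u x" using x by (simp add: v_def C_def)
  qed
  then show ?thesis
    by (rule that[of u, OF above _ cont]) (use below upper in \<open>auto simp: F_def\<close>)
qed

section \<open>From comparison with cones to viscosity solutions\<close>

text \<open>A cone is curved in the directions orthogonal to its axis \<open>e\<close>, and the more so the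
  closer to the vertex. Here \<open>(norm \<xi>)\<^sup>2 - (\<xi> \<bullet> e)\<^sup>2\<close> is the squared length of the part of \<open>\<xi>\<close>
  orthogonal to \<open>e\<close>. The constant 5 leaves room for the higher order terms of the square root.\<close>

lemma norm_shift_lower:
  fixes e \<xi> :: "'a::real_inner"
  assumes e: "norm e = 1" and s: "norm \<xi> \<le> s" "s > 0"
  shows "s + \<xi> \<bullet> e + ((norm \<xi>)\<^sup>2 - (\<xi> \<bullet> e)\<^sup>2) / (5 * s) \<le> norm (s *\<^sub>R e + \<xi>)"
proof (rule power2_le_imp_le)
  let ?\<alpha> = "\<xi> \<bullet> e"
  define B where "B = (norm \<xi>)\<^sup>2 - ?\<alpha>\<^sup>2"
  define A where "A = s + ?\<alpha>"
  have a: "\<bar>?\<alpha>\<bar> \<le> norm \<xi>" using Cauchy_Schwarz_ineq2[of \<xi> e] e by simp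
  have "?\<alpha>\<^sup>2 \<le> (norm \<xi>)\<^sup>2" using power_mono[OF a, of 2] by simp
  moreover have "(norm \<xi>)\<^sup>2 \<le> s\<^sup>2" using s by (intro power_mono) auto
  moreover have "0 \<le> ?\<alpha>\<^sup>2" by simp
  ultimately have B: "0 \<le> B" "B \<le> s\<^sup>2" unfolding B_def by linarith+
  have A: "0 \<le> A" "A \<le> 2 * s" using a s by (auto simp: A_def)
  have "(A + B / (5 * s))\<^sup>2 = A\<^sup>2 + B * (2 * A / (5 * s)) + B * (B / (25 * s\<^sup>2))"
    using s by (simp add: field_simps power2_eq_square)
  also have "\<dots> \<le> A\<^sup>2 + B * (4 / 5) + B * (1 / 25)"
    using A B s by (intro add_mono mult_left_mono order_refl) (auto simp: field_simps)
  also have "\<dots> \<le> A\<^sup>2 + B" using B by simp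
  also have "\<dots> = (norm (s *\<^sub>R e + \<xi>))\<^sup>2"
    using e unfolding power2_norm_eq_inner A_def B_def
    by (simp add: inner_add_left inner_add_right inner_commute power2_eq_square algebra_simps
        norm_eq_1)
  finally show "(s + ?\<alpha> + ((norm \<xi>)\<^sup>2 - ?\<alpha>\<^sup>2) / (5 * s))\<^sup>2 \<le> (norm (s *\<^sub>R e + \<xi>))\<^sup>2"
    by (simp add: A_def B_def)
qed simp

text \<open>If a quadratic form is negative along \<open>e\<close>, then it is dominated by a negative
  multiple of the square of the component along \<open>e\<close> plus a large multiple of the square of the
  orthogonal component: the mixed terms are absorbed by Young's inequality.\<close>

lemma negative_direction_quadratic_bound:
  fixes H :: "real ^ 'n ^ 'n"
  assumes e: "norm e = 1" and \<delta>: "e \<bullet> (H *v e) = - \<delta>" "\<delta> > 0"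
  obtains K where "K \<ge> 0" "\<And>\<xi>. (\<xi> \<bullet> (H *v \<xi>)) / 2 + (\<delta> / 8) * (norm \<xi>)\<^sup>2
     \<le> K * ((norm \<xi>)\<^sup>2 - (\<xi> \<bullet> e)\<^sup>2) - (\<delta> / 8) * (\<xi> \<bullet> e)\<^sup>2"
proof -
  define M where "M = onorm ((*v) H)"
  have bl: "bounded_linear ((*v) H)" by (rule matrix_vector_mul_bounded_linear)
  have M0: "M \<ge> 0" unfolding M_def by (rule onorm_pos_le[OF bl])
  have M: "\<bar>a \<bullet> (H *v b)\<bar> \<le> M * norm a * norm b" for a b
  proof -
    have "\<bar>a \<bullet> (H *v b)\<bar> \<le> norm a * norm (H *v b)" by (rule Cauchy_Schwarz_ineq2)
    also have "\<dots> \<le> norm a * (M * norm b)"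
      unfolding M_def by (intro mult_left_mono onorm[OF bl]) simp
    finally show ?thesis by (simp add: mult_ac)
  qed
  define K where "K = M\<^sup>2 / \<delta> + M / 2 + \<delta> / 8"
  have "(\<xi> \<bullet> (H *v \<xi>)) / 2 + (\<delta> / 8) * (norm \<xi>)\<^sup>2
     \<le> K * ((norm \<xi>)\<^sup>2 - (\<xi> \<bullet> e)\<^sup>2) - (\<delta> / 8) * (\<xi> \<bullet> e)\<^sup>2" for \<xi>
  proof -
    define \<alpha> where "\<alpha> = \<xi> \<bullet> e"
    define \<beta> where "\<beta> = \<xi> - \<alpha> *\<^sub>R e"
    define b where "b = norm \<beta>"
    have \<xi>: "\<xi> = \<alpha> *\<^sub>R e + \<beta>" by (simp add: \<beta>_def)
    have ee: "e \<bullet> e = 1" using e by (simp add: norm_eq_1)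
    have "\<beta> \<bullet> e = 0" by (simp add: \<beta>_def \<alpha>_def inner_diff_left ee)
    then have n: "(norm \<xi>)\<^sup>2 = \<alpha>\<^sup>2 + b\<^sup>2"
      unfolding b_def \<xi> power2_norm_eq_inner
      by (simp add: inner_add_left inner_add_right inner_commute ee power2_eq_square)
    have lin: "H *v \<xi> = \<alpha> *\<^sub>R (H *v e) + H *v \<beta>"
      by (subst \<xi>) (simp add: matrix_vector_right_distrib matrix_vector_mult_scaleR)
    have "\<xi> \<bullet> (H *v \<xi>) = \<alpha>\<^sup>2 * (e \<bullet> (H *v e)) + \<alpha> * (e \<bullet> (H *v \<beta>)) + \<alpha> * (\<beta> \<bullet> (H *v e)) + \<beta> \<bullet> (H *v \<beta>)"
      unfolding lin by (subst (1) \<xi>) (simp add: inner_add_left inner_add_right power2_eq_square algebra_simps)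
    also have "\<dots> \<le> - \<delta> * \<alpha>\<^sup>2 + \<bar>\<alpha>\<bar> * (M * b) + \<bar>\<alpha>\<bar> * (M * b) + M * b\<^sup>2"
    proof (intro add_mono)
      show "\<alpha>\<^sup>2 * (e \<bullet> (H *v e)) \<le> - \<delta> * \<alpha>\<^sup>2" using \<delta> by simp
      have "\<bar>\<alpha> * (e \<bullet> (H *v \<beta>))\<bar> \<le> \<bar>\<alpha>\<bar> * (M * b)"
        using M[of e \<beta>] e unfolding abs_mult b_def by (intro mult_left_mono) auto
      then show "\<alpha> * (e \<bullet> (H *v \<beta>)) \<le> \<bar>\<alpha>\<bar> * (M * b)" by linarith
      have "\<bar>\<alpha> * (\<beta> \<bullet> (H *v e))\<bar> \<le> \<bar>\<alpha>\<bar> * (M * b)"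
        using M[of \<beta> e] e unfolding abs_mult b_def by (intro mult_left_mono) auto
      then show "\<alpha> * (\<beta> \<bullet> (H *v e)) \<le> \<bar>\<alpha>\<bar> * (M * b)" by linarith
      show "\<beta> \<bullet> (H *v \<beta>) \<le> M * b\<^sup>2"
        using M[of \<beta> \<beta>] by (simp add: b_def power2_eq_square mult_ac)
    qed
    also have "\<dots> \<le> - (\<delta> / 2) * \<alpha>\<^sup>2 + (2 * M\<^sup>2 / \<delta> + M) * b\<^sup>2"
    proof -
      have "0 \<le> (\<delta> * \<bar>\<alpha>\<bar> - 2 * M * b)\<^sup>2 / (2 * \<delta>)" using \<delta> by simp
      also have "\<dots> = \<delta> / 2 * \<alpha>\<^sup>2 - 2 * \<bar>\<alpha>\<bar> * (M * b) + 2 * M\<^sup>2 / \<delta> * b\<^sup>2"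
      proof -
        have "\<bar>\<alpha>\<bar> * \<bar>\<alpha>\<bar> = \<alpha>\<^sup>2" by (simp add: power2_eq_square)
        then show ?thesis using \<delta> by (simp add: field_simps power2_eq_square)
      qed
      finally show ?thesis by (simp add: algebra_simps)
    qed
    finally have "(\<xi> \<bullet> (H *v \<xi>)) / 2 \<le> - (\<delta> / 4) * \<alpha>\<^sup>2 + (M\<^sup>2 / \<delta> + M / 2) * b\<^sup>2"
      by (simp add: field_simps)
    then show ?thesis
      unfolding n \<alpha>_def[symmetric] K_def by (simp add: algebra_simps)
  qed
  moreover have "K \<ge> 0" using M0 \<delta> by (simp add: K_def)
  ultimately show ?thesis using that by blast
qed

text \<open>If a test function \<open>\<phi>\<close> touching \<open>u\<close> from above at \<open>x\<close> had a negative infinity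
  Laplacian, its Hessian would be negative in the direction of its gradient \<open>p\<close>. A cone of slope
  \<open>norm p\<close> with vertex at distance \<open>s\<close> behind \<open>x\<close> has the same gradient at \<open>x\<close>; it is flat along
  \<open>p\<close> and has curvature of order \<open>1 / s\<close> across. For small \<open>s\<close> it therefore lies strictly above
  \<open>\<phi>\<close>, and thus above \<open>u\<close>, on a small sphere about \<open>x\<close>. A slightly lowered cone then still
  dominates \<open>u\<close> on the sphere, but not at the centre, against comparison with cones.\<close>

lemma comparison_imp_viscosity_subsolution:
  fixes u :: "real ^ 'n \<Rightarrow> real"
  assumes \<Omega>: "open \<Omega>" and u: "comparison_cones_above \<Omega> u"
  shows "viscosity_subsolution \<Omega> u"
  unfolding viscosity_subsolution_def
proof (intro allI ballI impI)
  fix \<phi> x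
  assume x: "x \<in> \<Omega>" and \<phi>: "C2_on \<Omega> \<phi>" and touch: "\<forall>\<^sub>F y in nhds x. u y - \<phi> y \<le> u x - \<phi> x"
  define p :: "real ^ 'n" where "p = (\<chi> i. partial i \<phi> x)"
  define H :: "real ^ 'n ^ 'n" where "H = (\<chi> i j. partial j (partial i \<phi>) x)"
  have lap: "inf_laplacian \<phi> x = p \<bullet> (H *v p)"
    by (simp add: inf_laplacian_def inner_vec_def matrix_vector_mult_def p_def H_def
        sum_distrib_left mult_ac)
  show "0 \<le> inf_laplacian \<phi> x"
  proof (rule ccontr)
    assume "\<not> 0 \<le> inf_laplacian \<phi> x"
    then have neg: "p \<bullet> (H *v p) < 0" by (simp add: lap)
    define P where "P = norm p"
    have "p \<noteq> 0" using neg by auto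
    then have P: "P > 0" by (simp add: P_def)
    define e where "e = (1 / P) *\<^sub>R p"
    have e: "norm e = 1" and pe: "p = P *\<^sub>R e" using P by (auto simp: e_def P_def)
    define \<delta> where "\<delta> = - (e \<bullet> (H *v e))"
    have "p \<bullet> (H *v p) = P\<^sup>2 * (e \<bullet> (H *v e))"
      by (simp add: pe matrix_vector_mult_scaleR power2_eq_square)
    then have \<delta>: "\<delta> > 0" "e \<bullet> (H *v e) = - \<delta>"
      using neg P by (auto simp: \<delta>_def mult_less_0_iff)
    obtain K where K: "K \<ge> 0" "\<And>\<xi>. (\<xi> \<bullet> (H *v \<xi>)) / 2 + (\<delta> / 8) * (norm \<xi>)\<^sup>2
        \<le> K * ((norm \<xi>)\<^sup>2 - (\<xi> \<bullet> e)\<^sup>2) - (\<delta> / 8) * (\<xi> \<bullet> e)\<^sup>2"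
      using negative_direction_quadratic_bound[OF e \<delta>(2,1)] by blast
    obtain r1 where r1: "r1 > 0" "\<And>\<xi>. norm \<xi> < r1 \<Longrightarrow> \<phi> (x + \<xi>) \<le> \<phi> x + \<xi> \<bullet> p
        + (\<xi> \<bullet> (H *v \<xi>)) / 2 + (\<delta> / 8) * (norm \<xi>)\<^sup>2"
    proof -
      have "\<delta> / 8 > 0" using \<delta> by simp
      from C2_taylor_upper[OF \<Omega> \<phi> x this] that show ?thesis
        by (auto simp: inner_vec_def matrix_vector_mult_def p_def H_def sum_distrib_left mult_ac)
    qed
    obtain r2 where r2: "r2 > 0" "\<And>y. dist y x < r2 \<Longrightarrow> u y - \<phi> y \<le> u x - \<phi> x"
      using touch unfolding eventually_nhds_metric by blast
    obtain r3 where r3: "r3 > 0" "cball x r3 \<subseteq> \<Omega>"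
      using \<Omega> x open_contains_cball by blast
    \<comment> \<open>makes the curvature term \<open>P / (5 * s)\<close> of the cone exceed the Taylor constant \<open>K\<close> by \<open>\<delta> / 8\<close>\<close>
    define s where "s = P / (5 * (K + \<delta> / 8))"
    have s: "s > 0" "P / (5 * s) = K + \<delta> / 8" using P K \<delta> by (auto simp: s_def)
    define z where "z = x - s *\<^sub>R e"
    define r where "r = min (min (r1 / 2) (r2 / 2)) (min r3 (s / 2))"
    have r: "r > 0" "r < r1" "r < r2" "r \<le> r3" "r < s"
      using r1 r2 r3 s by (auto simp: r_def)
    \<comment> \<open>the cone through the graph of \<open>u\<close> at \<open>x\<close>, lowered by the gap available on the sphere of radius \<open>r\<close>\<close>
    define c where "c = u x - P * s - \<delta> / 8 * r\<^sup>2"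
    have "u x \<le> c + P * dist x z"
    proof (rule comparison_cones_aboveD[OF u, where V = "ball x r"])
      show "closure (ball x r) \<subseteq> \<Omega>" using r r3 by auto
      show "z \<notin> ball x r" using r s e by (simp add: z_def dist_norm)
      show "x \<in> ball x r" using r by simp
      fix y assume "y \<in> frontier (ball x r)"
      then have y: "dist x y = r" using r by auto
      define \<xi> where "\<xi> = y - x"
      have \<xi>: "norm \<xi> = r" "y = x + \<xi>" using y by (auto simp: \<xi>_def dist_norm norm_minus_commute)
      have "u y \<le> u x + \<phi> (x + \<xi>) - \<phi> x"
        using r2(2)[of y] y r \<xi>(2) by (simp add: dist_commute)
      also have "\<dots> \<le> u x + \<xi> \<bullet> p + ((\<xi> \<bullet> (H *v \<xi>)) / 2 + (\<delta> / 8) * (norm \<xi>)\<^sup>2)"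
        using r1(2)[of \<xi>] \<xi> r by simp
      also have "\<dots> \<le> u x + \<xi> \<bullet> p + (K * ((norm \<xi>)\<^sup>2 - (\<xi> \<bullet> e)\<^sup>2) - (\<delta> / 8) * (\<xi> \<bullet> e)\<^sup>2)"
        using K(2) by simp
      also have "\<dots> = c + P * (s + \<xi> \<bullet> e) + (K + \<delta> / 8) * ((norm \<xi>)\<^sup>2 - (\<xi> \<bullet> e)\<^sup>2)"
        by (simp add: pe c_def \<xi> algebra_simps)
      also have "\<dots> = c + P * (s + \<xi> \<bullet> e + ((norm \<xi>)\<^sup>2 - (\<xi> \<bullet> e)\<^sup>2) / (5 * s))"
        unfolding s(2)[symmetric] by (simp add: distrib_left)
      also have "\<dots> \<le> c + P * norm (s *\<^sub>R e + \<xi>)"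
        using norm_shift_lower[OF e, of \<xi> s] \<xi> r s P by (intro add_left_mono mult_left_mono) auto
      also have "norm (s *\<^sub>R e + \<xi>) = dist y z"
        by (simp add: z_def \<xi> dist_norm algebra_simps)
      finally show "u y \<le> c + P * dist y z" .
    qed auto
    moreover have "dist x z = s" using s e by (simp add: z_def dist_norm)
    moreover have "\<delta> / 8 * r\<^sup>2 > 0" using \<delta> r by simp
    ultimately show False unfolding c_def by simp
  qed
qed

lemma comparison_imp_infinity_harmonic:
  fixes u :: "real ^ 'n \<Rightarrow> real"
  assumes "open \<Omega>" "comparison_cones_above \<Omega> u" "comparison_cones_below \<Omega> u" "continuous_on \<Omega> u"
  shows "infinity_harmonic_on \<Omega> u"
  unfolding infinity_harmonic_on_def viscosity_supersolution_iff_uminus[OF assms(1)]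
  by (intro conjI assms comparison_imp_viscosity_subsolution
      assms(3)[unfolded comparison_cones_below_def])

section \<open>The Dirichlet problem with prescribed growth\<close>

lemma comparison_cones_above_cong:
  assumes "comparison_cones_above \<Omega> u" "\<And>x. x \<in> \<Omega> \<Longrightarrow> v x = u x"
  shows "comparison_cones_above \<Omega> v"
  unfolding comparison_cones_above_def
proof (intro allI impI ballI, elim conjE)
  fix V z a b y
  assume V: "open V" "bounded V" "closure V \<subseteq> \<Omega>" "z \<notin> V" "\<forall>y\<in>frontier V. v y \<le> a + b * dist y z" "y \<in> V"
  have "y \<in> \<Omega>" "frontier V \<subseteq> \<Omega>" using V closure_subset by (auto simp: frontier_def)
  then show "v y \<le> a + b * dist y z"
    using assms V comparison_cones_aboveD[OF assms(1) V(1-4), of a b y] by (auto simp: subset_iff)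
qed

text \<open>A continuous function on a compact set lies, up to \<open>e\<close>, between two opposite cones with
  vertex on its graph. The cones can be made as steep as desired.\<close>

lemma cone_modulus:
  fixes g :: "'a::metric_space \<Rightarrow> real"
  assumes "compact S" "continuous_on S g" "z \<in> S" "e > 0"
  obtains K where "K \<ge> L" "\<And>y. y \<in> S \<Longrightarrow> \<bar>g y - g z\<bar> \<le> e + K * dist y z"
proof -
  obtain d where d: "d > 0" "\<And>y. \<lbrakk>y \<in> S; dist y z < d\<rbrakk> \<Longrightarrow> dist (g y) (g z) < e"
    using assms unfolding continuous_on_iff by meson
  obtain B where B: "\<And>y. y \<in> S \<Longrightarrow> \<bar>g y\<bar> \<le> B"
    using compact_imp_bounded[OF compact_continuous_image[OF assms(2,1)]]
    by (auto simp: bounded_iff)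
  have B0: "B \<ge> 0" using B[OF assms(3)] by simp
  define K where "K = max L (2 * B / d)"
  have K0: "2 * B / d \<le> K" "0 \<le> K" using B0 d(1) by (auto simp: K_def intro: max.coboundedI2)
  have "\<bar>g y - g z\<bar> \<le> e + K * dist y z" if "y \<in> S" for y
  proof (cases "dist y z < d")
    case True
    then show ?thesis using d(2)[OF that True] mult_nonneg_nonneg[OF K0(2) zero_le_dist[of y z]]
      by (simp add: dist_real_def)
  next
    case False
    have "\<bar>g y - g z\<bar> \<le> 2 * B" using B[OF that] B[OF assms(3)] by linarith
    also have "\<dots> = (2 * B / d) * d" using d by simp
    also have "\<dots> \<le> K * dist y z" using K0 False d by (intro mult_mono) auto
    finally show ?thesis using assms(4) by linarith
  qed
  then show ?thesis using that[of K] by (simp add: K_def)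
qed

text \<open>Upper barriers are \<open>\<psi> + M\<close> and all cones of slope at least \<open>L\<close> with vertex on the
  frontier that dominate the boundary values; the function \<open>\<psi> + m\<close> and the reflected cones lie
  below all of them. Perron's solution is squeezed in between. The cones enforce the boundary values
  with continuity, and \<open>\<psi> + m\<close>, \<open>\<psi> + M\<close> control the behaviour at infinity.\<close>

theorem cone_dirichlet_problem:
  fixes g \<psi> :: "'a::euclidean_space \<Rightarrow> real"
  assumes \<Omega>: "open \<Omega>" and fr: "compact (frontier \<Omega>)" "frontier \<Omega> \<noteq> {}"
    and g: "continuous_on (frontier \<Omega>) g"
    and \<psi>: "\<And>V. \<lbrakk>open V; bounded V; closure V \<subseteq> \<Omega>\<rbrakk> \<Longrightarrow> steep_on V L \<psi>"
    and mM: "\<And>y. y \<in> frontier \<Omega> \<Longrightarrow> \<psi> y + m \<le> g y" "\<And>y. y \<in> frontier \<Omega> \<Longrightarrow> g y \<le> \<psi> y + M"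
  obtains u where "comparison_cones_above \<Omega> u" "comparison_cones_below \<Omega> u"
    "continuous_on (closure \<Omega>) u" "\<And>y. y \<in> frontier \<Omega> \<Longrightarrow> u y = g y"
    "\<And>x. x \<in> closure \<Omega> \<Longrightarrow> \<psi> x + m \<le> u x" "\<And>x. x \<in> closure \<Omega> \<Longrightarrow> u x \<le> \<psi> x + M"
proof -
  have "steep_on {} L \<psi>" using \<psi>[of "{}"] by simp
  note L0 = steep_on_lipschitz(1)[OF this] and lip = steep_on_lipschitz(2)[OF this]
    and \<psi>_cont = steep_on_lipschitz(3)[OF this]
  have cont\<psi>: "continuous_on S (\<lambda>x. \<psi> x + k)" for S k
    by (intro continuous_intros \<psi>_cont)
  define \<U> where "\<U> = insert (\<lambda>x. \<psi> x + M) {\<lambda>x. a + K * dist x z | a K z.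
      z \<in> frontier \<Omega> \<and> L \<le> K \<and> (\<forall>y\<in>frontier \<Omega>. g y \<le> a + K * dist y z)}"
  have notin: "z \<notin> \<Omega>" if "z \<in> frontier \<Omega>" for z
    using that \<Omega> by (simp add: frontier_def interior_open)
  have U: "comparison_cones_below \<Omega> U" if "U \<in> \<U>" for U
    using that unfolding \<U>_def
  proof (elim insertE CollectE exE conjE)
    assume "U = (\<lambda>x. \<psi> x + M)"
    then show ?thesis using steep_imp_comparison(2)[OF steep_add_const[OF \<psi>]] by simp
  next
    fix a K z assume "U = (\<lambda>x. a + K * dist x z)" "z \<in> frontier \<Omega>"
    then show ?thesis using cone_comparison(2)[OF notin] by simp
  qed
  have lower_cone: "a - K * dist x z \<le> U x"
    if z: "z \<in> frontier \<Omega>" "L \<le> K" "\<And>y. y \<in> frontier \<Omega> \<Longrightarrow> a - K * dist y z \<le> g y" and U: "U \<in> \<U>"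
    for a K z U x
    using U unfolding \<U>_def
  proof (elim insertE CollectE exE conjE)
    assume [simp]: "U = (\<lambda>x. \<psi> x + M)"
    have "a \<le> \<psi> z + M" using z(3)[OF z(1)] mM(2)[OF z(1)] by simp
    moreover have "L * dist x z \<le> K * dist x z" using z by (simp add: mult_right_mono)
    ultimately show ?thesis using lip[of x z] by simp
  next
    fix a' K' z'
    assume [simp]: "U = (\<lambda>x. a' + K' * dist x z')"
      and z': "z' \<in> frontier \<Omega>" "L \<le> K'" "\<forall>y\<in>frontier \<Omega>. g y \<le> a' + K' * dist y z'"
    \<comment> \<open>both estimates for \<open>a\<close> hold at a vertex of one of the cones; the smaller slope serves for both\<close>
    define k where "k = min K K'"
    have "a \<le> a' + K * dist z' z"
      using z(3)[OF z'(1)] bspec[OF z'(3) z'(1)] by simp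
    moreover have "a \<le> a' + K' * dist z z'"
      using z(3)[OF z(1)] bspec[OF z'(3) z(1)] by simp
    ultimately have "a \<le> a' + k * dist z z'"
      by (auto simp: k_def min_def dist_commute)
    also have "\<dots> \<le> a' + k * (dist x z' + dist x z)"
      using L0 z(2) z'(2) dist_triangle[of z z' x]
      by (intro add_left_mono mult_left_mono) (auto simp: k_def dist_commute)
    also have "\<dots> \<le> a' + (K' * dist x z' + K * dist x z)"
      unfolding distrib_left by (intro add_mono order_refl mult_right_mono) (auto simp: k_def)
    finally show ?thesis by simp
  qed
  have lo: "\<psi> x + m \<le> U x" if U: "U \<in> \<U>" for U x
    using U unfolding \<U>_def
  proof (elim insertE CollectE exE conjE)
    assume "U = (\<lambda>x. \<psi> x + M)"
    moreover obtain y where "y \<in> frontier \<Omega>" using fr by blast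
    ultimately show ?thesis using mM[of y] by simp
  next
    fix a K z
    assume [simp]: "U = (\<lambda>x. a + K * dist x z)"
      and z: "z \<in> frontier \<Omega>" "L \<le> K" "\<forall>y\<in>frontier \<Omega>. g y \<le> a + K * dist y z"
    have "\<psi> z + m \<le> a" using bspec[OF z(3) z(1)] mM(1)[OF z(1)] by simp
    moreover have "L * dist x z \<le> K * dist x z" using z by (simp add: mult_right_mono)
    ultimately show ?thesis using lip[of x z] by simp
  qed
  obtain w where w: "comparison_cones_above \<Omega> w" "comparison_cones_below \<Omega> w" "continuous_on \<Omega> w"
    and wU: "\<And>U x. \<lbrakk>U \<in> \<U>; x \<in> \<Omega>\<rbrakk> \<Longrightarrow> w x \<le> U x"
    and wmax: "\<And>h x. \<lbrakk>comparison_cones_above \<Omega> h; \<And>U x. \<lbrakk>U \<in> \<U>; x \<in> \<Omega>\<rbrakk> \<Longrightarrow> h x \<le> U x; x \<in> \<Omega>\<rbrakk>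
       \<Longrightarrow> h x \<le> w x"
    by (rule perron[of \<Omega> \<U> "\<lambda>x. \<psi> x + m" "\<lambda>x. \<psi> x + M"])
      (use \<Omega> U lo steep_imp_comparison(1)[OF steep_add_const[OF \<psi>]] cont\<psi> in \<open>auto simp: \<U>_def\<close>)
  have near: "\<exists>K\<ge>L. \<forall>x\<in>closure \<Omega>. \<bar>(if x \<in> \<Omega> then w x else g x) - g z\<bar> \<le> e + K * dist x z"
    if z: "z \<in> frontier \<Omega>" and e: "e > 0" for z e
  proof -
    obtain K where K: "K \<ge> L" "\<And>y. y \<in> frontier \<Omega> \<Longrightarrow> \<bar>g y - g z\<bar> \<le> e + K * dist y z"
      using cone_modulus[OF fr(1) g z e] by blast
    have "(\<lambda>x. (g z + e) + K * dist x z) \<in> \<U>"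
      unfolding \<U>_def
    proof (intro insertI2 CollectI exI conjI ballI)
      show "g y \<le> (g z + e) + K * dist y z" if "y \<in> frontier \<Omega>" for y
        using K(2)[OF that] by linarith
    qed (use z K in auto)
    from wU[OF this] have 1: "w x \<le> g z + e + K * dist x z" if "x \<in> \<Omega>" for x using that by simp
    have 2: "(g z - e) + (- K) * dist x z \<le> w x" if "x \<in> \<Omega>" for x
    proof (rule wmax[OF _ _ that])
      show "comparison_cones_above \<Omega> (\<lambda>x. (g z - e) + (- K) * dist x z)"
        by (rule cone_comparison(1)[OF notin[OF z]])
      show "g z - e + - K * dist x z \<le> U x" if "U \<in> \<U>" for U x
      proof -
        have "g z - e - K * dist y z \<le> g y" if "y \<in> frontier \<Omega>" for y
          using K(2)[OF that] by linarith
        from lower_cone[OF z K(1) this \<open>U \<in> \<U>\<close>] show ?thesis by simp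
      qed
    qed
    have "\<bar>(if x \<in> \<Omega> then w x else g x) - g z\<bar> \<le> e + K * dist x z" if "x \<in> closure \<Omega>" for x
    proof (cases "x \<in> \<Omega>")
      case True
      then show ?thesis using 1[of x] 2[of x] by (simp add: abs_le_iff)
    next
      case False
      then have "x \<in> frontier \<Omega>" using that \<Omega> by (simp add: frontier_def interior_open)
      then show ?thesis using K(2) False by simp
    qed
    then show ?thesis using K by blast
  qed
  define u where "u x = (if x \<in> \<Omega> then w x else g x)" for x
  have uw: "u x = w x" if "x \<in> \<Omega>" for x using that by (simp add: u_def)
  have ug: "u x = g x" if "x \<in> frontier \<Omega>" for x
    using that \<Omega> by (simp add: u_def frontier_def interior_open)
  have split: "x \<in> \<Omega> \<or> x \<in> frontier \<Omega>" if "x \<in> closure \<Omega>" for x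
    using that \<Omega> by (simp add: frontier_def interior_open)
  show ?thesis
  proof (rule that[of u])
    show "comparison_cones_above \<Omega> u" by (rule comparison_cones_above_cong[OF w(1) uw])
    show "comparison_cones_below \<Omega> u"
      unfolding comparison_cones_below_def
      by (rule comparison_cones_above_cong[OF w(2)[unfolded comparison_cones_below_def]]) (simp add: uw)
    show "u y = g y" if "y \<in> frontier \<Omega>" for y by (rule ug[OF that])
    show "\<psi> x + m \<le> u x" if "x \<in> closure \<Omega>" for x
      using split[OF that]
    proof
      assume x: "x \<in> \<Omega>"
      have "\<psi> x + m \<le> w x"
        by (rule wmax[where h = "\<lambda>x. \<psi> x + m"])
          (use lo x steep_imp_comparison(1)[OF steep_add_const[OF \<psi>]] in auto)
      then show ?thesis by (simp add: uw x)
    qed (simp add: ug mM)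
    show "u x \<le> \<psi> x + M" if "x \<in> closure \<Omega>" for x
      using split[OF that] wU[of "\<lambda>x. \<psi> x + M" x] by (auto simp: \<U>_def uw ug mM)
    show "continuous_on (closure \<Omega>) u"
      unfolding continuous_on_eq_continuous_within
    proof
      fix x assume "x \<in> closure \<Omega>"
      then consider "x \<in> \<Omega>" | "x \<in> frontier \<Omega>" using split by blast
      then show "continuous (at x within closure \<Omega>) u"
      proof cases
        case x: 1
        have "continuous_on \<Omega> u" using w(3) uw continuous_on_cong[of \<Omega> \<Omega> u w] by simp
        then show ?thesis
          using x \<Omega> continuous_on_eq_continuous_at continuous_at_imp_continuous_at_within by blast
      next
        case z: 2
        show ?thesis
          unfolding continuous_within_eps_delta
        proof (intro allI impI)
          fix e :: real assume e: "e > 0"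
          obtain K where K: "K \<ge> L" "\<And>y. y \<in> closure \<Omega> \<Longrightarrow> \<bar>u y - g x\<bar> \<le> e / 2 + K * dist y x"
            using near[OF z, of "e/2"] e by (auto simp: u_def)
          define d where "d = e / (2 * (K + 1))"
          have "d > 0" using e K L0 by (simp add: d_def)
          moreover have "dist (u y) (u x) < e" if "y \<in> closure \<Omega>" "dist y x < d" for y
          proof -
            have "K * dist y x \<le> (K + 1) * dist y x" by (simp add: mult_right_mono)
            also have "\<dots> < (K + 1) * d" using that K L0 by (intro mult_strict_left_mono) auto
            also have "\<dots> = e / 2"
            proof -
              have "2 * K + 2 \<noteq> 0" using K(1) L0 by linarith
              then show ?thesis by (simp add: d_def field_simps)
            qed
            finally show ?thesis using K(2)[OF that(1)] ug[OF z] by (simp add: dist_real_def)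
          qed
          ultimately show "\<exists>d>0. \<forall>y\<in>closure \<Omega>. dist y x < d \<longrightarrow> dist (u y) (u x) < e" by blast
        qed
      qed
    qed
  qed
qed

section \<open>The cone estimate for viscosity subsolutions\<close>

text \<open>The profile \<open>F\<close> is taken as a function of the squared radius, so that \<open>\<phi>\<close> is smooth
  at the centre as well.\<close>

lemma radial_C2_inf_laplacian:
  fixes x :: "real ^ 'n" and F F' F'' :: "real \<Rightarrow> real"
  assumes F: "\<And>t. t \<ge> 0 \<Longrightarrow> (F has_real_derivative F' t) (at t)"
    and F': "\<And>t. t \<ge> 0 \<Longrightarrow> (F' has_real_derivative F'' t) (at t)"
    and F'': "continuous_on {0..} F''"
  defines "\<phi> \<equiv> \<lambda>y. F ((norm (y - x))\<^sup>2)"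
  shows "C2_on S \<phi>"
    and "inf_laplacian \<phi> y = 8 * (F' ((norm (y - x))\<^sup>2))\<^sup>2 * (norm (y - x))\<^sup>2 *
           (F' ((norm (y - x))\<^sup>2) + 2 * (norm (y - x))\<^sup>2 * F'' ((norm (y - x))\<^sup>2))"
proof -
  define \<rho> where "\<rho> y = (y - x) \<bullet> (y - x)" for y
  have \<rho>0: "\<rho> y \<ge> 0" for y by (simp add: \<rho>_def)
  have \<phi>: "\<phi> = (\<lambda>y. F (\<rho> y))" by (simp add: \<phi>_def \<rho>_def power2_norm_eq_inner)
  have d\<rho>: "(\<rho> has_derivative (\<lambda>h. 2 * ((y - x) \<bullet> h))) (at y)" for y
    unfolding \<rho>_def by (auto intro!: derivative_eq_intros simp: inner_commute)
  have compose: "((\<lambda>y. G (\<rho> y)) has_derivative (\<lambda>h. 2 * ((y - x) \<bullet> h) * G' (\<rho> y))) (at y)"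
    if "\<And>t. t \<ge> 0 \<Longrightarrow> (G has_real_derivative G' t) (at t)" for G G' y
    using has_derivative_compose[OF d\<rho>[of y] that[OF \<rho>0, unfolded has_field_derivative_def]]
    by (simp add: mult.commute)
  have p1: "partial i \<phi> y = 2 * (y - x) $ i * F' (\<rho> y)" for i y
    using partial_eq_derivative[OF compose[OF F]] by (simp add: \<phi> inner_axis)
  have d2: "(partial i \<phi> has_derivative
      (\<lambda>h. 2 * h $ i * F' (\<rho> y) + 2 * (y - x) $ i * (2 * ((y - x) \<bullet> h) * F'' (\<rho> y)))) (at y)" for i y
  proof -
    have "((\<lambda>y. (y - x) $ i) has_derivative (\<lambda>h. h $ i)) (at y)"
      by (auto intro!: derivative_eq_intros bounded_linear_imp_has_derivative bounded_linear_vec_nth)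
    from has_derivative_mult[OF has_derivative_mult_right[OF this, of 2] compose[OF F']]
    show ?thesis
      unfolding p1[abs_def] by (rule has_derivative_eq_rhs) (auto simp: fun_eq_iff algebra_simps)
  qed
  have p2: "partial j (partial i \<phi>) y
      = 2 * (if i = j then 1 else 0) * F' (\<rho> y) + 4 * (y - x) $ i * (y - x) $ j * F'' (\<rho> y)" for i j y
  proof -
    have "axis j 1 $ i = (if i = j then 1 else 0 :: real)" by (simp add: axis_def)
    then show ?thesis
      using partial_eq_derivative[OF d2[of i y], of j] by (simp add: inner_axis algebra_simps)
  qed
  have diff: "\<phi> differentiable (at y)" for y
    unfolding \<phi> using compose[OF F] by (auto simp: differentiable_def)
  have diff1: "partial i \<phi> differentiable (at y)" for i y
    using d2 by (auto simp: differentiable_def)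
  have cont_diff: "continuous_on S f" if "\<And>y. f differentiable (at y)" for f :: "real ^ 'n \<Rightarrow> real"
    using that by (intro continuous_at_imp_continuous_on ballI differentiable_imp_continuous_within)
  have cF: "continuous_on S (\<lambda>y. G (\<rho> y))" if "continuous_on {0..} G" for G
    by (rule continuous_on_compose2[OF that]) (auto simp: \<rho>_def intro!: continuous_intros)
  have cF': "continuous_on {0..} F'"
    by (intro continuous_at_imp_continuous_on ballI DERIV_isCont[OF F']) simp
  have "continuous_on S (partial j (partial i \<phi>))" for i j
    unfolding p2[abs_def] by (intro continuous_intros cF F'' cF')
  then show "C2_on S \<phi>"
    using diff diff1 cont_diff by (auto simp: C2_on_def C1_on_def)
  define f where "f = F' (\<rho> y)"
  define q where "q = F'' (\<rho> y)"
  define \<xi> where "\<xi> = y - x"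
  have \<rho>: "(\<Sum>i\<in>UNIV. \<xi> $ i * \<xi> $ i) = \<rho> y" by (simp add: \<rho>_def inner_vec_def \<xi>_def)
  have "inf_laplacian \<phi> y = (\<Sum>i\<in>UNIV. \<Sum>j\<in>UNIV. 2 * \<xi> $ i * f * (2 * \<xi> $ j * f) *
      (2 * (if i = j then 1 else 0) * f + 4 * \<xi> $ i * \<xi> $ j * q))"
    by (simp add: inf_laplacian_def p1 p2 f_def q_def \<xi>_def)
  also have "\<dots> = (\<Sum>i\<in>UNIV. \<Sum>j\<in>UNIV. (if i = j then 8 * f ^ 3 * (\<xi> $ i * \<xi> $ i) else 0)
      + 16 * f\<^sup>2 * q * ((\<xi> $ i * \<xi> $ i) * (\<xi> $ j * \<xi> $ j)))"
    by (intro sum.cong refl) (auto simp: algebra_simps power2_eq_square power3_eq_cube)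
  also have "\<dots> = 8 * f ^ 3 * \<rho> y + 16 * f\<^sup>2 * q * (\<rho> y * \<rho> y)"
    unfolding sum.distrib by (simp add: sum_distrib_left[symmetric] sum_distrib_right[symmetric] \<rho>)
  also have "\<dots> = 8 * f\<^sup>2 * \<rho> y * (f + 2 * \<rho> y * q)"
    by (simp add: algebra_simps power2_eq_square power3_eq_cube)
  finally show "inf_laplacian \<phi> y = 8 * (F' ((norm (y - x))\<^sup>2))\<^sup>2 * (norm (y - x))\<^sup>2 *
           (F' ((norm (y - x))\<^sup>2) + 2 * (norm (y - x))\<^sup>2 * F'' ((norm (y - x))\<^sup>2))"
    by (simp add: f_def q_def \<rho>_def power2_norm_eq_inner)
qed

text \<open>Away from the centre this is a perturbed cone that is strictly infinity superharmonic
  as soon as \<open>e\<close> is small compared with \<open>\<gamma>\<close>, and it is a global test function because the vertex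
  has been smoothed.\<close>

lemma smoothed_cone:
  fixes x :: "real ^ 'n" and b c \<gamma> :: real
  assumes e: "e > 0"
  defines "\<phi> \<equiv> \<lambda>y. b * sqrt ((norm (y - x))\<^sup>2 + e) - \<gamma> * (norm (y - x))\<^sup>2 + c"
  shows "C2_on S \<phi>"
    and "\<And>y q. q = sqrt ((norm (y - x))\<^sup>2 + e) \<Longrightarrow>
      inf_laplacian \<phi> y = 8 * (b / (2 * q) - \<gamma>)\<^sup>2 * (norm (y - x))\<^sup>2 * (b * e / (2 * q ^ 3) - \<gamma>)"
proof -
  define F where "F t = b * sqrt (t + e) - \<gamma> * t + c" for t
  define F' where "F' t = b / (2 * sqrt (t + e)) - \<gamma>" for t
  define F'' where "F'' t = - b / (4 * sqrt (t + e) ^ 3)" for t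
  have 1: "(F has_real_derivative F' t) (at t)" if "t \<ge> 0" for t
    unfolding F_def F'_def using that e
    by (auto intro!: derivative_eq_intros simp: field_simps)
  have 2: "(F' has_real_derivative F'' t) (at t)" if "t \<ge> 0" for t
    unfolding F'_def F''_def using that e
    by (auto intro!: derivative_eq_intros simp: field_simps power3_eq_cube)
  have 3: "continuous_on {0..} F''"
    unfolding F''_def using e by (auto intro!: continuous_intros)
  note R = radial_C2_inf_laplacian[where F = F and F' = F' and F'' = F'' and x = x, OF 1 2 3]
  show "C2_on S \<phi>" using R(1) by (simp add: \<phi>_def F_def)
  fix y q assume q: "q = sqrt ((norm (y - x))\<^sup>2 + e)"
  have q0: "q > 0" "q\<^sup>2 = (norm (y - x))\<^sup>2 + e"
    using e by (auto simp: q add_nonneg_pos)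
  have "inf_laplacian \<phi> y = 8 * (b / (2 * q) - \<gamma>)\<^sup>2 * (norm (y - x))\<^sup>2 *
     (b / (2 * q) - \<gamma> + 2 * (q\<^sup>2 - e) * (- b / (4 * q ^ 3)))"
    using R(2)[of y] by (simp add: \<phi>_def F_def F'_def F''_def q[symmetric] q0(2))
  also have "b / (2 * q) - \<gamma> + 2 * (q\<^sup>2 - e) * (- b / (4 * q ^ 3)) = b * e / (2 * q ^ 3) - \<gamma>"
    using q0(1) by (simp add: field_simps power2_eq_square power3_eq_cube)
  finally show "inf_laplacian \<phi> y = 8 * (b / (2 * q) - \<gamma>)\<^sup>2 * (norm (y - x))\<^sup>2 * (b * e / (2 * q ^ 3) - \<gamma>)" .
qed

text \<open>Suppose that \<open>u w\<close> exceeds the cone with vertex \<open>x\<close>. Slightly increase the slope, subtract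
  \<open>\<gamma>\<close> times the squared distance and smooth the vertex; the difference of \<open>u\<close> and the resulting
  function \<open>\<phi>\<close> still has a positive maximum. It is not attained on the sphere, where \<open>\<phi>\<close>
  exceeds \<open>M\<close>, nor near \<open>x\<close>, where the constant \<open>\<gamma> * R\<^sup>2\<close> and the continuity of \<open>u\<close> keep \<open>\<phi>\<close>
  above \<open>u\<close>. So \<open>\<phi>\<close> touches \<open>u\<close> from above at a point where its infinity Laplacian is
  negative. The parameters are chosen in the order \<open>\<gamma>\<close>, then the radius \<open>r0\<close> around \<open>x\<close>, then \<open>e\<close>.\<close>

lemma viscosity_subsolution_cone_estimate:
  fixes u :: "real ^ 'n \<Rightarrow> real"
  assumes sub: "viscosity_subsolution \<Omega> u" and cont: "continuous_on \<Omega> u"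
    and ball: "cball x R \<subseteq> \<Omega>" and R: "R > 0"
    and M: "\<And>y. y \<in> cball x R \<Longrightarrow> u y \<le> M" and w: "w \<in> cball x R"
  shows "u w \<le> u x + (M - u x) / R * dist w x"
proof (rule ccontr)
  define \<sigma> where "\<sigma> = (M - u x) / R"
  have \<sigma>: "\<sigma> \<ge> 0" "\<sigma> * R = M - u x" using M[of x] R by (auto simp: \<sigma>_def)
  assume "\<not> u w \<le> u x + (M - u x) / R * dist w x"
  define d where "d = u w - u x - \<sigma> * norm (w - x)"
  have d: "d > 0"
    using \<open>\<not> u w \<le> _\<close> by (simp add: d_def \<sigma>_def dist_norm)
  \<comment> \<open>extra slope: makes \<open>\<phi>\<close> exceed \<open>M\<close> on the sphere, at the cost of \<open>d / 4\<close> at \<open>w\<close>\<close>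
  define b where "b = \<sigma> + d / (4 * R)"
  have b: "b > 0" using \<sigma> d R by (simp add: b_def add_nonneg_pos)
  \<comment> \<open>the first bound costs another \<open>d / 4\<close> at \<open>w\<close>, the second keeps the radial derivative of \<open>\<phi>\<close> positive\<close>
  define \<gamma> where "\<gamma> = min (d / (4 * R\<^sup>2)) (b / (8 * R))"
  have \<gamma>: "\<gamma> > 0" "\<gamma> * R\<^sup>2 \<le> d / 4" "\<gamma> \<le> b / (8 * R)"
  proof -
    show "\<gamma> > 0" using d b R by (simp add: \<gamma>_def)
    have "\<gamma> \<le> d / (4 * R\<^sup>2)" unfolding \<gamma>_def by (rule min.cobounded1)
    then show "\<gamma> * R\<^sup>2 \<le> d / 4" using R by (simp add: field_simps)
    show "\<gamma> \<le> b / (8 * R)" unfolding \<gamma>_def by (rule min.cobounded2)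
  qed
  have "isCont u x" if "open \<Omega>'" "x \<in> \<Omega>'" "\<Omega>' \<subseteq> \<Omega>" for \<Omega>'
    using continuous_on_subset[OF cont that(3)] that continuous_on_eq_continuous_at by blast
  then have "isCont u x" using ball R by (meson ball_subset_cball centre_in_ball open_ball subset_trans)
  then obtain r1 where r1: "r1 > 0" "\<And>y. dist y x < r1 \<Longrightarrow> dist (u y) (u x) < \<gamma> * R\<^sup>2 / 2"
    using \<gamma> R unfolding continuous_at_eps_delta by (metis divide_pos_pos mult_pos_pos zero_less_numeral zero_less_power)
  define r0 where "r0 = min r1 (R / 2)"
  have r0: "r0 > 0" "r0 \<le> r1" "r0 \<le> R / 2" unfolding r0_def using r1 R by auto
  \<comment> \<open>bounds the square root of \<open>e\<close>, so that smoothing costs at most \<open>d / 4\<close>\<close>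
  define k where "k = min R (min (d / (4 * b)) r0)"
  have k: "k > 0" "k \<le> R" "b * k \<le> d / 4"
  proof -
    show "k > 0" using R d b r0 by (simp add: k_def)
    show "k \<le> R" by (simp add: k_def)
    have "k \<le> d / (4 * b)" unfolding k_def by (simp add: min.coboundedI1 min.coboundedI2)
    then show "b * k \<le> d / 4" using b by (simp add: field_simps)
  qed
  define e where "e = min (k\<^sup>2) (\<gamma> * r0 ^ 3 / b)"
  have e: "e > 0" "e \<le> k\<^sup>2" "b * e \<le> \<gamma> * r0 ^ 3"
  proof -
    show "e > 0" using k \<gamma> r0 b by (simp add: e_def)
    show "e \<le> k\<^sup>2" by (simp add: e_def)
    have "e \<le> \<gamma> * r0 ^ 3 / b" by (simp add: e_def)
    then show "b * e \<le> \<gamma> * r0 ^ 3" using b by (simp add: field_simps)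
  qed
  define c where "c = u x + \<gamma> * R\<^sup>2"
  define \<phi> where "\<phi> y = b * sqrt ((norm (y - x))\<^sup>2 + e) - \<gamma> * (norm (y - x))\<^sup>2 + c" for y
  have q_lo: "norm (y - x) \<le> sqrt ((norm (y - x))\<^sup>2 + e)" for y
    using e by (intro real_le_rsqrt) simp
  have q_hi: "sqrt ((norm (y - x))\<^sup>2 + e) \<le> norm (y - x) + k" for y
  proof (rule real_le_lsqrt)
    show "(norm (y - x))\<^sup>2 + e \<le> (norm (y - x) + k)\<^sup>2"
    proof -
      have "0 \<le> 2 * norm (y - x) * k" using k by simp
      then show ?thesis using e(2) unfolding power2_sum by linarith
    qed
  qed (use k in simp)
  have \<phi>lo: "\<phi> y \<ge> u x + b * norm (y - x) + \<gamma> * (R\<^sup>2 - (norm (y - x))\<^sup>2)" for y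
    using mult_left_mono[OF q_lo[of y], of b] b by (simp add: \<phi>_def c_def algebra_simps)
  have "compact (cball x R)" by simp
  moreover have "continuous_on (cball x R) (\<lambda>y. u y - \<phi> y)"
    unfolding \<phi>_def by (intro continuous_intros continuous_on_subset[OF cont ball])
  ultimately obtain y where y: "y \<in> cball x R"
    and ymax: "\<And>v. v \<in> cball x R \<Longrightarrow> u v - \<phi> v \<le> u y - \<phi> y"
    using continuous_attains_sup[of "cball x R" "\<lambda>y. u y - \<phi> y"] R by auto
  have "u w - \<phi> w > 0"
  proof -
    have wR: "norm (w - x) \<le> R" using w by (simp add: dist_norm norm_minus_commute)
    have "b * sqrt ((norm (w - x))\<^sup>2 + e) \<le> b * (norm (w - x) + k)"
      using q_hi b by (intro mult_left_mono) auto
    moreover have "0 \<le> \<gamma> * (norm (w - x))\<^sup>2" using \<gamma> by simp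
    ultimately have "\<phi> w \<le> b * (norm (w - x) + k) + c" unfolding \<phi>_def by linarith
    also have "\<dots> \<le> u x + \<sigma> * norm (w - x) + d / (4 * R) * norm (w - x) + d / 4 + d / 4"
    proof -
      have "b * norm (w - x) = \<sigma> * norm (w - x) + d / (4 * R) * norm (w - x)"
        by (simp add: b_def distrib_right)
      then show ?thesis unfolding c_def distrib_left using k(3) \<gamma>(2) by linarith
    qed
    finally have "\<phi> w \<le> u x + \<sigma> * norm (w - x) + d / (4 * R) * norm (w - x) + d / 4 + d / 4" .
    moreover have "d / (4 * R) * norm (w - x) \<le> d / (4 * R) * R"
      using wR d R by (intro mult_left_mono) auto
    moreover have "d / (4 * R) * R = d / 4" using R by simp
    moreover have "u w = u x + \<sigma> * norm (w - x) + d" by (simp add: d_def)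
    ultimately show ?thesis using d by linarith
  qed
  then have pos: "u y > \<phi> y" using ymax[OF w] by linarith
  define r where "r = norm (y - x)"
  have rR: "r < R"
  proof (rule ccontr)
    assume "\<not> r < R"
    then have "norm (y - x) = R" using y by (simp add: r_def dist_norm norm_minus_commute)
    then have "\<phi> y \<ge> u x + b * R" using \<phi>lo[of y] by simp
    moreover have "b * R \<ge> \<sigma> * R" using R d by (simp add: b_def)
    ultimately show False using pos M[OF y] \<sigma> by simp
  qed
  have rr0: "r \<ge> r0"
  proof (rule ccontr)
    assume "\<not> r \<ge> r0"
    then have r: "r < r0" by simp
    have "dist (u y) (u x) < \<gamma> * R\<^sup>2 / 2"
      using r r0(2) by (intro r1(2)) (simp add: r_def dist_norm)
    then have "u y < u x + \<gamma> * R\<^sup>2 / 2" unfolding dist_real_def by linarith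
    moreover have "r\<^sup>2 \<le> (R / 2)\<^sup>2" using r r0 by (intro power_mono) (auto simp: r_def)
    then have "4 * r\<^sup>2 \<le> R\<^sup>2" by (simp add: power_divide)
    then have "R\<^sup>2 / 2 \<le> R\<^sup>2 - r\<^sup>2" using zero_le_power2[of r] by linarith
    then have "\<gamma> * (R\<^sup>2 / 2) \<le> \<gamma> * (R\<^sup>2 - r\<^sup>2)"
      using \<gamma> by (intro mult_left_mono) auto
    moreover have "b * r \<ge> 0" using b by (simp add: r_def)
    ultimately show False using \<phi>lo[of y] pos by (simp add: r_def)
  qed
  define q where "q = sqrt (r\<^sup>2 + e)"
  have q: "r \<le> q" "q \<le> 2 * R" "q > 0"
  proof -
    show "r \<le> q" using q_lo[of y] by (simp add: q_def r_def)
    then show "q > 0" using rr0 r0 by linarith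
    have "q \<le> r + k" using q_hi[of y] by (simp add: q_def r_def)
    then show "q \<le> 2 * R" using rR k(2) by linarith
  qed
  have "b / (2 * q) \<ge> b / (2 * (2 * R))"
    using b q by (intro divide_left_mono) auto
  moreover have "b / (2 * (2 * R)) > b / (8 * R)" using b R by (simp add: field_simps)
  ultimately have f: "b / (2 * q) - \<gamma> > 0" using \<gamma>(3) by linarith
  have "r0 ^ 3 \<le> q ^ 3" using r0 rr0 q by (intro power_mono) auto
  then have "b * e \<le> \<gamma> * q ^ 3" using e(3) \<gamma> by (meson mult_left_mono order_trans less_imp_le)
  moreover have "\<gamma> * q ^ 3 < 2 * (\<gamma> * q ^ 3)" using \<gamma> q by simp
  ultimately have "b * e / (2 * q ^ 3) < \<gamma>"
    using q(3) by (simp add: divide_less_eq mult_ac)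
  moreover have "inf_laplacian \<phi> y = 8 * (b / (2 * q) - \<gamma>)\<^sup>2 * r\<^sup>2 * (b * e / (2 * q ^ 3) - \<gamma>)"
    using smoothed_cone(2)[OF e(1), of q y x b \<gamma> c] by (simp add: \<phi>_def[abs_def] q_def r_def)
  moreover have "8 * (b / (2 * q) - \<gamma>)\<^sup>2 * r\<^sup>2 > 0" using f rr0 r0 by simp
  ultimately have "inf_laplacian \<phi> y < 0" by (metis diff_less_0_iff_less mult_pos_neg)
  moreover have "inf_laplacian \<phi> y \<ge> 0"
  proof -
    have "\<forall>\<^sub>F v in nhds y. v \<in> ball x R"
      using rR by (intro eventually_nhds_in_open) (auto simp: r_def dist_norm norm_minus_commute)
    then have "\<forall>\<^sub>F v in nhds y. u v - \<phi> v \<le> u y - \<phi> y"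
      by eventually_elim (use ymax in auto)
    moreover have "C2_on \<Omega> \<phi>" unfolding \<phi>_def by (rule smoothed_cone(1)[OF e(1)])
    ultimately show ?thesis using sub y ball unfolding viscosity_subsolution_def by blast
  qed
  ultimately show False by linarith
qed

section \<open>Comparison for a finite difference equation\<close>

text \<open>One round of tug-of-war with step \<open>\<epsilon>\<close>: the maximizing player can gain (almost) \<open>s\<close>,
  and the minimizing player cannot push the value down by more than \<open>s\<close>. Having such an \<open>s\<close> is
  a finite difference form of being infinity subharmonic, and \<open>s / \<epsilon>\<close> is the slope.\<close>

definition ascent :: "real \<Rightarrow> ('a::metric_space \<Rightarrow> real) \<Rightarrow> 'a \<Rightarrow> real \<Rightarrow> bool"
  where "ascent \<epsilon> U x s \<longleftrightarrow>
    (\<forall>\<kappa>>0. \<exists>z\<in>cball x \<epsilon>. U z \<ge> U x + s - \<kappa>) \<and> (\<forall>y\<in>cball x \<epsilon>. U y \<ge> U x - s)"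

text \<open>Think of \<open>- w\<close> as the supersolution. Suppose that \<open>D = U + w\<close> is within \<open>\<eta>\<close> of its
  supremum \<open>K > k\<close> at some point. The rise of \<open>w\<close> over one step from there cannot exceed that of \<open>U\<close> by
  more than \<open>2 * \<eta>\<close>, so a step uphill for \<open>U\<close> leads to a point where \<open>D\<close> is still within \<open>4 * \<eta>\<close> of \<open>K\<close>.
  As long as this defect is small the point remains in \<open>Y\<close>, and \<open>U\<close> gains about \<open>\<delta>\<close> each time. The
  number of steps after which the bound \<open>M\<close> is violated does not depend on \<open>\<eta>\<close>, so a tiny initial
  defect gives a contradiction. Almost maximal points thus take the place of maximum points, which may fail to
  exist in an unbounded domain.\<close>

theorem strict_discrete_comparison:
  fixes U w :: "'a::metric_space \<Rightarrow> real"
  assumes Y: "\<And>x. x \<in> Y \<Longrightarrow> cball x \<epsilon> \<subseteq> X"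
    and U: "\<And>x. x \<in> Y \<Longrightarrow> \<exists>s\<ge>\<delta>. ascent \<epsilon> U x s" and \<delta>: "\<delta> > 0"
    and w: "\<And>x. x \<in> Y \<Longrightarrow> \<exists>t. ascent \<epsilon> w x t"
    and M: "\<And>x. x \<in> X \<Longrightarrow> U x \<le> M" "\<And>x. x \<in> X \<Longrightarrow> w x \<le> M"
    and k: "\<And>x. x \<in> X - Y \<Longrightarrow> U x + w x \<le> k"
    and x: "x \<in> X"
  shows "U x + w x \<le> k"
proof (rule ccontr)
  assume neg: "\<not> U x + w x \<le> k"
  define D where "D y = U y + w y" for y
  define K where "K = (SUP y\<in>X. D y)"
  have bdd: "bdd_above (D ` X)"
    unfolding D_def using M by (intro bdd_aboveI2[of _ _ "M + M"] add_mono)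
  have DK: "D y \<le> K" if "y \<in> X" for y
    unfolding K_def using that bdd by (intro cSUP_upper)
  have kK: "k < K" using DK[OF x] neg by (simp add: D_def)
  define d where "d = min (K - k) (\<delta> / 2)"
  have d: "d > 0" "d \<le> K - k" "d \<le> \<delta> / 2" 
  proof -
    show "d > 0" using kK \<delta> by (simp add: d_def)
  qed (unfold d_def, rule min.cobounded1, rule min.cobounded2)
  have climb: "\<exists>z\<in>X. U z \<ge> U x + real n * (\<delta> / 2)"
    if "x \<in> X" "\<eta> > 0" "4 ^ n * \<eta> < d" "D x \<ge> K - \<eta>" for n \<eta> x
    using that
  proof (induction n arbitrary: x \<eta>)
    case 0 then show ?case by auto
  next
    case (Suc n)
    have "\<eta> * 1 \<le> \<eta> * 4 ^ Suc n"
      using Suc.prems(2) by (intro mult_left_mono one_le_power) auto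
    then have \<eta>d: "\<eta> < d" using Suc.prems(3) by (simp add: mult.commute)
    then have "x \<in> Y" using k[of x] Suc.prems(1,4) d by (force simp: D_def)
    obtain s where s: "s \<ge> \<delta>" "ascent \<epsilon> U x s" using U \<open>x \<in> Y\<close> by blast
    obtain t where t: "ascent \<epsilon> w x t" using w \<open>x \<in> Y\<close> by blast
    obtain y where y: "y \<in> cball x \<epsilon>" "w y \<ge> w x + t - \<eta>"
      using t Suc.prems(2) unfolding ascent_def by blast
    have "U y \<ge> U x - s" using s(2) y(1) unfolding ascent_def by blast
    moreover have "D y \<le> K" using DK Y \<open>x \<in> Y\<close> y(1) by blast
    ultimately have ts: "t \<le> s + 2 * \<eta>" using y(2) Suc.prems(4) by (simp add: D_def)
    obtain z where z: "z \<in> cball x \<epsilon>" "U z \<ge> U x + s - \<eta>"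
      using s(2) Suc.prems(2) unfolding ascent_def by blast
    have "w z \<ge> w x - t" using t z(1) unfolding ascent_def by blast
    then have Dz: "D z \<ge> K - 4 * \<eta>" using z(2) ts Suc.prems(4) by (simp add: D_def)
    have "z \<in> X" using Y \<open>x \<in> Y\<close> z(1) by blast
    then obtain z' where "z' \<in> X" "U z' \<ge> U z + real n * (\<delta> / 2)"
      using Suc.IH[of z "4 * \<eta>"] Suc.prems(2,3) Dz by (auto simp: mult_ac)
    moreover have "U z \<ge> U x + \<delta> / 2" using z(2) s(1) \<eta>d d by linarith
    ultimately show ?case by (intro bexI[of _ z']) (auto simp: algebra_simps add_divide_distrib)
  qed
  obtain n :: nat where n: "real n * (\<delta> / 2) > 2 * M - K + d"
    using reals_Archimedean3[of "\<delta> / 2"] \<delta> half_gt_zero by blast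
  define \<eta> where "\<eta> = d / (2 * 4 ^ n)"
  have \<eta>: "\<eta> > 0" "4 ^ n * \<eta> < d" "\<eta> < d"
  proof -
    show "\<eta> > 0" "4 ^ n * \<eta> < d" using d by (auto simp: \<eta>_def)
    have "\<eta> * 1 \<le> \<eta> * 4 ^ n" using \<open>\<eta> > 0\<close> by (intro mult_left_mono) auto
    then show "\<eta> < d" using \<open>4 ^ n * \<eta> < d\<close> by (simp add: mult.commute)
  qed
  have "K - \<eta> < (SUP y\<in>X. D y)" using \<eta>(1) by (simp add: K_def)
  then obtain y where y: "y \<in> X" "K - \<eta> < D y"
    using x bdd less_cSUP_iff[of X D "K - \<eta>"] by blast
  then obtain z where "z \<in> X" "U z \<ge> U y + real n * (\<delta> / 2)"
    using climb[of y \<eta> n] \<eta> by auto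
  then show False
    using M(1)[of z] M(2)[OF y(1)] n y \<eta> by (simp add: D_def)
qed

text \<open>A walk of \<open>n\<close> steps of length at most \<open>\<epsilon>\<close> that stays in \<open>V\<close> until it stops at its
  first point in \<open>X - V\<close>.\<close>

inductive chain :: "'a::metric_space set \<Rightarrow> 'a set \<Rightarrow> real \<Rightarrow> nat \<Rightarrow> 'a \<Rightarrow> 'a \<Rightarrow> bool"
  for X V \<epsilon>
  where
    stop: "x \<in> X - V \<Longrightarrow> chain X V \<epsilon> 0 x x"
  | step: "\<lbrakk>x \<in> V; y \<in> cball x \<epsilon>; chain X V \<epsilon> n y z\<rbrakk> \<Longrightarrow> chain X V \<epsilon> (Suc n) x z"

lemma chain_inside: "chain X V \<epsilon> n x z \<Longrightarrow> x \<in> V \<Longrightarrow>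
    \<exists>m y. n = Suc m \<and> y \<in> cball x \<epsilon> \<and> chain X V \<epsilon> m y z"
  by (erule chain.cases) auto

text \<open>Walk straight towards \<open>a\<close>. Since \<open>a\<close> is outside \<open>X\<close>, the walk has to leave \<open>V\<close>
  before it gets there.\<close>

lemma chain_towards_outside_point:
  fixes a :: "'a::real_normed_vector"
  assumes V: "\<And>x. x \<in> V \<Longrightarrow> cball x \<epsilon> \<subseteq> X" and a: "a \<notin> X" and \<epsilon>: "\<epsilon> > 0"
    and x: "x \<in> X" "dist x a \<le> real m * \<epsilon>"
  shows "\<exists>n\<le>m. \<exists>z. chain X V \<epsilon> n x z"
  using x
proof (induction m arbitrary: x)
  case 0
  then show ?case using a by auto
next
  case (Suc m)
  show ?case
  proof (cases "x \<in> V")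
    case False
    then show ?thesis using chain.stop[of x X V \<epsilon>] Suc.prems by blast
  next
    case True
    have "a \<notin> cball x \<epsilon>" using V[OF True] a by blast
    then have far: "dist x a > \<epsilon>" "x \<noteq> a" using \<epsilon> by auto
    define y where "y = x + (\<epsilon> / dist x a) *\<^sub>R (a - x)"
    have "dist x y = \<epsilon>" using far \<epsilon> by (auto simp: y_def dist_norm norm_minus_commute)
    then have y: "y \<in> cball x \<epsilon>" by simp
    have "y - a = (1 - \<epsilon> / dist x a) *\<^sub>R (x - a)" by (simp add: y_def algebra_simps)
    moreover have "\<epsilon> / dist x a < 1" using far \<epsilon> by (subst divide_less_eq_1_pos) auto
    ultimately have "dist y a = (1 - \<epsilon> / dist x a) * dist x a"
      by (simp add: dist_norm)
    also have "\<dots> = dist x a - \<epsilon>" using far \<epsilon> by (simp add: left_diff_distrib)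
    finally have "dist y a \<le> real m * \<epsilon>" using Suc.prems(2) by (simp add: algebra_simps)
    then obtain n z where "n \<le> m" "chain X V \<epsilon> n y z"
      using Suc.IH[of y] V[OF True] y by blast
    then show ?thesis using chain.step[OF True y] by (meson Suc_le_mono)
  qed
qed

text \<open>Strictness can be produced at a small cost. Let \<open>V\<close> be the set where \<open>U\<close> varies by
  less than \<open>\<delta>\<close> over one step. Outside \<open>V\<close> keep \<open>U\<close>; inside \<open>V\<close> let \<open>T x\<close> be the best value of \<open>U\<close> that can
  be reached by a walk leaving \<open>V\<close>, minus \<open>\<delta>\<close> for each step (the solution of a discrete eikonal
  equation). In \<open>V\<close> the rise per step becomes exactly \<open>\<delta>\<close> by dynamic programming. At a point outside
  \<open>V\<close> the uphill step of \<open>U\<close> ends outside \<open>V\<close> too, since \<open>U\<close> varies by less than \<open>\<delta>\<close> over one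
  step from a point of \<open>V\<close>; so nothing changes there. As \<open>U\<close> varies little along walks in \<open>V\<close>,
  \<open>T\<close> falls short of \<open>U\<close> by at most \<open>2 * \<delta>\<close> per step.\<close>

lemma steepening:
  fixes U :: "'a::real_normed_vector \<Rightarrow> real"
  assumes Y: "\<And>x. x \<in> Y \<Longrightarrow> cball x \<epsilon> \<subseteq> X" and \<epsilon>: "\<epsilon> > 0" and a: "a \<notin> X"
    and U: "\<And>x. x \<in> Y \<Longrightarrow> \<exists>s. (\<exists>z\<in>cball x \<epsilon>. U z = U x + s) \<and> (\<forall>y\<in>cball x \<epsilon>. \<bar>U y - U x\<bar> \<le> s)"
    and \<delta>: "\<delta> > 0"
  obtains T where "\<And>x. x \<in> Y \<Longrightarrow> \<exists>s\<ge>\<delta>. ascent \<epsilon> T x s"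
    "\<And>x. x \<in> X \<Longrightarrow> T x \<le> U x"
    "\<And>x m. \<lbrakk>x \<in> X; dist x a \<le> real m * \<epsilon>\<rbrakk> \<Longrightarrow> T x \<ge> U x - 2 * \<delta> * real m"
proof -
  define V where "V = {x \<in> Y. \<forall>y\<in>cball x \<epsilon>. \<bar>U y - U x\<bar> < \<delta>}"
  have V: "x \<in> Y" "\<And>y. y \<in> cball x \<epsilon> \<Longrightarrow> \<bar>U y - U x\<bar> < \<delta>" if "x \<in> V" for x
    using that by (auto simp: V_def)
  have VX: "cball x \<epsilon> \<subseteq> X" "x \<in> X" if "x \<in> V" for x
    using Y[OF V(1)[OF that]] \<epsilon> by auto
  let ?ch = "chain X V \<epsilon>"
  have slope: "\<bar>U z - U x\<bar> \<le> \<delta> * real n" if "?ch n x z" for n x z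
    using that
  proof induction
    case (step x y n z)
    then show ?case using V(2)[OF step(1,2)] by (simp add: algebra_simps)
  qed simp
  define T where "T x = (SUP p\<in>{(n, z). ?ch n x z}. U (snd p) - \<delta> * real (fst p))" for x
  have bdd: "bdd_above ((\<lambda>p. U (snd p) - \<delta> * real (fst p)) ` {(n, z). ?ch n x z})" for x
  proof (intro bdd_aboveI[of _ "U x"])
    fix v assume "v \<in> (\<lambda>p. U (snd p) - \<delta> * real (fst p)) ` {(n, z). ?ch n x z}"
    then obtain n z where "?ch n x z" "v = U z - \<delta> * real n" by auto
    then show "v \<le> U x" using slope[of n x z] by linarith
  qed
  have upper: "U z - \<delta> * real n \<le> T x" if "?ch n x z" for n x z
    unfolding T_def using cSUP_upper[OF _ bdd, of "(n, z)" x] that by simp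
  have ex: "\<exists>n\<le>m. \<exists>z. ?ch n x z" if "x \<in> X" "dist x a \<le> real m * \<epsilon>" for x m
    by (rule chain_towards_outside_point[OF VX(1) a \<epsilon> that])
  have nonempty: "\<exists>n z. ?ch n x z" if x: "x \<in> X" for x
  proof -
    obtain m :: nat where "dist x a < real m * \<epsilon>" using reals_Archimedean3[OF \<epsilon>] by blast
    then show ?thesis using ex[OF x, of m] by auto
  qed
  have least: "T x \<le> c" if "x \<in> X" "\<And>n z. ?ch n x z \<Longrightarrow> U z - \<delta> * real n \<le> c" for x c
    unfolding T_def using nonempty[OF that(1)] that(2) by (intro cSUP_least) auto
  have TU: "T x \<le> U x" if "x \<in> X" for x
    using slope by (intro least[OF that]) (force simp: abs_le_iff)
  have T_outside: "T x = U x" if "x \<in> X" "x \<notin> V" for x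
    using upper[OF chain.stop, of x] TU[of x] that by simp
  have T_drop: "T y \<ge> T x - \<delta>" if "y \<in> V" "x \<in> cball y \<epsilon>" "x \<in> X" for x y
  proof -
    have "T x \<le> T y + \<delta>"
    proof (rule least[OF that(3)])
      fix n z assume "?ch n x z"
      from upper[OF chain.step[OF that(1,2) this]] show "U z - \<delta> * real n \<le> T y + \<delta>"
        by (simp add: algebra_simps)
    qed
    then show ?thesis by simp
  qed
  have asc_V: "ascent \<epsilon> T x \<delta>" if x: "x \<in> V" for x
    unfolding ascent_def
  proof (intro conjI allI impI ballI)
    fix \<kappa> :: real assume "\<kappa> > 0"
    then obtain n z where nz: "?ch n x z" "T x - \<kappa> < U z - \<delta> * real n"
      using least[OF VX(2)[OF x], of "T x - \<kappa>"] by fastforce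
    then obtain m y where y: "n = Suc m" "y \<in> cball x \<epsilon>" "?ch m y z"
      using chain_inside[OF nz(1) x] by blast
    have "T x + \<delta> - \<kappa> \<le> T y" using upper[OF y(3)] nz(2) y(1) by (simp add: algebra_simps)
    then show "\<exists>z\<in>cball x \<epsilon>. T x + \<delta> - \<kappa> \<le> T z" using y(2) by blast
  next
    fix y assume y: "y \<in> cball x \<epsilon>"
    then have yX: "y \<in> X" using VX(1)[OF x] by blast
    show "T x - \<delta> \<le> T y"
    proof (cases "y \<in> V")
      case True
      then show ?thesis using T_drop[of y x] y VX[OF x] by (simp add: dist_commute)
    next
      case False
      then show ?thesis using T_outside[OF yX] TU[OF VX(2)[OF x]] V(2)[OF x y] by linarith
    qed
  qed
  have asc: "\<exists>s\<ge>\<delta>. ascent \<epsilon> T x s" if xY: "x \<in> Y" for x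
  proof (cases "x \<in> V")
    case True
    then show ?thesis using asc_V by blast
  next
    case False
    obtain s z where s: "z \<in> cball x \<epsilon>" "U z = U x + s" "\<And>y. y \<in> cball x \<epsilon> \<Longrightarrow> \<bar>U y - U x\<bar> \<le> s"
      using U[OF xY] by blast
    obtain y where "y \<in> cball x \<epsilon>" "\<bar>U y - U x\<bar> \<ge> \<delta>"
      using False xY by (force simp: V_def)
    then have s\<delta>: "s \<ge> \<delta>" using s(3) by force
    have xX: "x \<in> X" and ballX: "cball x \<epsilon> \<subseteq> X" using Y[OF xY] \<epsilon> by auto
    have Tx: "T x = U x" using T_outside[OF xX False] .
    have "z \<notin> V"
      using V(2)[of z x] s(1,2) s\<delta> by (auto simp: dist_commute)
    then have Tz: "T z = T x + s" using T_outside[of z] s ballX Tx by auto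
    have "ascent \<epsilon> T x s"
      unfolding ascent_def
    proof (intro conjI allI impI ballI)
      fix \<kappa> :: real assume "\<kappa> > 0"
      then show "\<exists>z\<in>cball x \<epsilon>. T x + s - \<kappa> \<le> T z" using Tz s(1) by (intro bexI[of _ z]) auto
    next
      fix y assume y: "y \<in> cball x \<epsilon>"
      show "T x - s \<le> T y"
      proof (cases "y \<in> V")
        case True
        then show ?thesis using T_drop[of y x] y xX s\<delta> by (force simp: dist_commute)
      next
        case False
        then show ?thesis using T_outside[of y] s(3)[OF y] y ballX Tx by (force simp: abs_le_iff)
      qed
    qed
    then show ?thesis using s\<delta> by blast
  qed
  have low: "T x \<ge> U x - 2 * \<delta> * real m" if x: "x \<in> X" "dist x a \<le> real m * \<epsilon>" for x m
  proof -
    obtain n z where n: "n \<le> m" "?ch n x z" using ex[OF x] by blast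
    have "\<delta> * real n \<le> \<delta> * real m" using n(1) \<delta> by simp
    then show ?thesis using slope[OF n(2)] upper[OF n(2)] by linarith
  qed
  show ?thesis by (rule that[OF asc TU low])
qed

text \<open>Make \<open>U\<close> strict by steepening. For fixed \<open>x\<close> the loss is at most \<open>2 * \<delta> * m\<close> with \<open>m\<close>
  independent of \<open>\<delta>\<close>, so it disappears as \<open>\<delta>\<close> tends to 0.\<close>

theorem discrete_comparison:
  fixes U w :: "'a::real_normed_vector \<Rightarrow> real"
  assumes Y: "\<And>x. x \<in> Y \<Longrightarrow> cball x \<epsilon> \<subseteq> X" and \<epsilon>: "\<epsilon> > 0" and a: "a \<notin> X"
    and U: "\<And>x. x \<in> Y \<Longrightarrow> \<exists>s. (\<exists>z\<in>cball x \<epsilon>. U z = U x + s) \<and> (\<forall>y\<in>cball x \<epsilon>. \<bar>U y - U x\<bar> \<le> s)"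
    and w: "\<And>x. x \<in> Y \<Longrightarrow> \<exists>s. (\<exists>z\<in>cball x \<epsilon>. w z = w x + s) \<and> (\<forall>y\<in>cball x \<epsilon>. \<bar>w y - w x\<bar> \<le> s)"
    and M: "\<And>x. x \<in> X \<Longrightarrow> U x \<le> M" "\<And>x. x \<in> X \<Longrightarrow> w x \<le> M"
    and k: "\<And>x. x \<in> X - Y \<Longrightarrow> U x + w x \<le> k"
    and x: "x \<in> X"
  shows "U x + w x \<le> k"
proof -
  have w': "\<exists>t. ascent \<epsilon> w y t" if y: "y \<in> Y" for y
  proof -
    obtain s z where s: "z \<in> cball y \<epsilon>" "w z = w y + s" "\<And>v. v \<in> cball y \<epsilon> \<Longrightarrow> \<bar>w v - w y\<bar> \<le> s"
      using w[OF y] by blast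
    have "ascent \<epsilon> w y s"
      unfolding ascent_def
    proof (intro conjI allI impI ballI)
      fix \<kappa> :: real assume "\<kappa> > 0"
      then show "\<exists>z\<in>cball y \<epsilon>. w y + s - \<kappa> \<le> w z" using s by (intro bexI[of _ z]) auto
    next
      fix v assume "v \<in> cball y \<epsilon>"
      then show "w y - s \<le> w v" using s(3) by (force simp: abs_le_iff)
    qed
    then show ?thesis by blast
  qed
  obtain m :: nat where m: "dist x a < real m * \<epsilon>" using reals_Archimedean3[OF \<epsilon>] by blast
  have "U x + w x \<le> k + \<kappa>" if "\<kappa> > 0" for \<kappa>
  proof -
    \<comment> \<open>the summand 1 only guards against division by 0\<close>
    define \<delta> where "\<delta> = \<kappa> / (2 * real m + 1)"
    have \<delta>: "\<delta> > 0" using that by (simp add: \<delta>_def)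
    obtain T where T: "\<And>x. x \<in> Y \<Longrightarrow> \<exists>s\<ge>\<delta>. ascent \<epsilon> T x s" "\<And>x. x \<in> X \<Longrightarrow> T x \<le> U x"
      "\<And>x m. \<lbrakk>x \<in> X; dist x a \<le> real m * \<epsilon>\<rbrakk> \<Longrightarrow> T x \<ge> U x - 2 * \<delta> * real m"
      using steepening[where Y = Y and X = X and \<epsilon> = \<epsilon> and U = U, OF Y \<epsilon> a U \<delta>] by blast
    have "T x + w x \<le> k"
    proof (rule strict_discrete_comparison[where U = T and w = w and Y = Y, OF Y T(1) \<delta> w' _ M(2) _ x])
      show "T y \<le> M" if "y \<in> X" for y using T(2)[OF that] M(1)[OF that] by linarith
      show "T y + w y \<le> k" if "y \<in> X - Y" for y using T(2)[of y] k[OF that] that by force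
    qed auto
    moreover have "2 * \<delta> * real m \<le> \<kappa>"
    proof -
      have "2 * \<delta> * real m \<le> \<delta> * (2 * real m + 1)" using \<delta> by (simp add: algebra_simps)
      then show ?thesis by (simp add: \<delta>_def)
    qed
    ultimately show ?thesis using T(3)[OF x, of m] m by linarith
  qed
  then show ?thesis by (rule field_le_epsilon)
qed

section \<open>Comparison in exterior domains\<close>

definition ball_sup :: "real \<Rightarrow> ('a::metric_space \<Rightarrow> real) \<Rightarrow> 'a \<Rightarrow> real"
  where "ball_sup \<epsilon> u x = (SUP y\<in>cball x \<epsilon>. u y)"

lemma ball_sup_attained:
  fixes u :: "'a::heine_borel \<Rightarrow> real"
  assumes "continuous_on (cball x \<epsilon>) u" "\<epsilon> \<ge> 0"
  obtains y where "y \<in> cball x \<epsilon>" "ball_sup \<epsilon> u x = u y" "\<And>z. z \<in> cball x \<epsilon> \<Longrightarrow> u z \<le> ball_sup \<epsilon> u x"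
proof -
  obtain y where y: "y \<in> cball x \<epsilon>" "\<And>z. z \<in> cball x \<epsilon> \<Longrightarrow> u z \<le> u y"
    using continuous_attains_sup[of "cball x \<epsilon>" u] assms by auto
  have "ball_sup \<epsilon> u x = u y"
    unfolding ball_sup_def using y by (intro cSup_eq_maximum) auto
  then show ?thesis using that y by simp
qed

text \<open>The observation of Armstrong and Smart. The largest value of \<open>ball_sup \<epsilon> u\<close> over the
  \<open>\<epsilon>\<close>-ball is the maximum \<open>m\<close> of \<open>u\<close> over the ball of radius \<open>2 * \<epsilon>\<close>, and the smallest one is at
  least \<open>u x\<close>. The cone estimate with \<open>M = m\<close>, taken half-way out, says that \<open>ball_sup \<epsilon> u x\<close> is at
  most the mean of \<open>u x\<close> and \<open>m\<close>, so that the drop is no larger than the rise.\<close>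

lemma ball_sup_balanced:
  fixes u :: "'a::euclidean_space \<Rightarrow> real"
  assumes \<epsilon>: "\<epsilon> > 0" and cont: "continuous_on (cball x (2 * \<epsilon>)) u"
    and cone: "\<And>M y. \<lbrakk>\<And>z. z \<in> cball x (2 * \<epsilon>) \<Longrightarrow> u z \<le> M; y \<in> cball x (2 * \<epsilon>)\<rbrakk>
      \<Longrightarrow> u y \<le> u x + (M - u x) / (2 * \<epsilon>) * dist y x"
  shows "\<exists>s. (\<exists>z\<in>cball x \<epsilon>. ball_sup \<epsilon> u z = ball_sup \<epsilon> u x + s) \<and>
    (\<forall>y\<in>cball x \<epsilon>. \<bar>ball_sup \<epsilon> u y - ball_sup \<epsilon> u x\<bar> \<le> s)"
proof -
  have sub: "cball y \<epsilon> \<subseteq> cball x (2 * \<epsilon>)" if "y \<in> cball x \<epsilon>" for y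
  proof
    fix v assume "v \<in> cball y \<epsilon>"
    then show "v \<in> cball x (2 * \<epsilon>)" using that dist_triangle[of x v y] by auto
  qed
  have att: "\<exists>v\<in>cball y \<epsilon>. ball_sup \<epsilon> u y = u v"
    and le: "\<And>v. v \<in> cball y \<epsilon> \<Longrightarrow> u v \<le> ball_sup \<epsilon> u y" if "y \<in> cball x \<epsilon>" for y
    using ball_sup_attained[OF continuous_on_subset[OF cont sub[OF that]]] \<epsilon> by (metis less_imp_le)+
  obtain z0 where z0: "z0 \<in> cball x (2 * \<epsilon>)" "\<And>v. v \<in> cball x (2 * \<epsilon>) \<Longrightarrow> u v \<le> u z0"
    using ball_sup_attained[OF cont] \<epsilon> by (metis less_imp_le mult_pos_pos zero_less_numeral)
  have x: "x \<in> cball x \<epsilon>" using \<epsilon> by simp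
  have top: "ball_sup \<epsilon> u y \<le> u z0" if "y \<in> cball x \<epsilon>" for y
    using att[OF that] sub[OF that] z0(2) by fastforce
  define z where "z = midpoint x z0"
  have z: "z \<in> cball x \<epsilon>" "z0 \<in> cball z \<epsilon>"
    using z0(1) by (auto simp: z_def dist_midpoint)
  then have Uz: "ball_sup \<epsilon> u z = u z0" using le[OF z(1) z(2)] top[OF z(1)] by simp
  define s where "s = u z0 - ball_sup \<epsilon> u x"
  obtain y0 where y0: "y0 \<in> cball x \<epsilon>" "ball_sup \<epsilon> u x = u y0" using att[OF x] by blast
  have mid: "2 * ball_sup \<epsilon> u x \<le> u x + u z0"
  proof -
    have "u y0 \<le> u x + (u z0 - u x) / (2 * \<epsilon>) * dist y0 x"
      by (rule cone) (use z0(2) sub[OF x] y0 in auto)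
    also have "\<dots> \<le> u x + (u z0 - u x) / (2 * \<epsilon>) * \<epsilon>"
      using y0(1) z0(2)[of x] \<epsilon>
      by (intro add_left_mono mult_left_mono) (auto simp: dist_commute)
    finally have "u y0 \<le> u x + (u z0 - u x) / 2" using \<epsilon> by simp
    then show ?thesis unfolding y0(2) by (simp add: field_simps)
  qed
  have "\<bar>ball_sup \<epsilon> u y - ball_sup \<epsilon> u x\<bar> \<le> s" if y: "y \<in> cball x \<epsilon>" for y
  proof -
    have "x \<in> cball y \<epsilon>" using y by (simp add: dist_commute)
    then show ?thesis using le[OF y, of x] top[OF y] mid by (simp add: s_def abs_le_iff)
  qed
  then show ?thesis using z(1) Uz by (intro exI[of _ s]) (auto simp: s_def)
qed

text \<open>Replacing \<open>u\<close> and \<open>- v\<close> by their suprema over \<open>\<epsilon>\<close>-balls turns both into discrete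
  subsolutions on the set \<open>X\<close> of points farther than \<open>\<epsilon>\<close> from \<open>A\<close>, and it only increases them.
  In the boundary layer \<open>X - Y\<close> all points involved are close to a common frontier point, where \<open>u\<close>
  is at most \<open>v\<close>; as the frontier is compact, uniform continuity bounds the sum by \<open>2 * \<kappa>\<close> there
  once \<open>\<epsilon>\<close> is small.\<close>

theorem exterior_comparison:
  fixes u v :: "real ^ 'n \<Rightarrow> real"
  assumes A: "compact A" "A \<noteq> {}"
    and u: "viscosity_subsolution (- A) u" "continuous_on (closure (- A)) u" "\<And>x. x \<in> - A \<Longrightarrow> u x \<le> M"
    and v: "viscosity_supersolution (- A) v" "continuous_on (closure (- A)) v" "\<And>x. x \<in> - A \<Longrightarrow> - M \<le> v x"
    and le: "\<And>x. x \<in> frontier A \<Longrightarrow> u x \<le> v x"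
    and x: "x \<in> - A"
  shows "u x \<le> v x"
proof -
  let ?\<Omega> = "- A"
  have op: "open ?\<Omega>" using A(1) by (simp add: compact_imp_closed open_Compl)
  define w where "w y = - v y" for y
  have w: "viscosity_subsolution ?\<Omega> w" "continuous_on (closure ?\<Omega>) w" "\<And>x. x \<in> ?\<Omega> \<Longrightarrow> w x \<le> M"
    using v(3) v(1,2) viscosity_supersolution_iff_uminus[OF op, of v]
    by (auto simp: w_def[abs_def] intro: continuous_intros) (simp add: v(3) minus_le_iff)
  obtain a where a: "a \<in> A" using A(2) by blast
  obtain \<epsilon>0 where \<epsilon>0: "\<epsilon>0 > 0" "cball x \<epsilon>0 \<subseteq> ?\<Omega>"
    using op x open_contains_cball by blast
  obtain B where B: "\<And>p. p \<in> A \<Longrightarrow> norm p \<le> B"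
    using compact_imp_bounded[OF A(1)] by (auto simp: bounded_iff)
  \<comment> \<open>a compact part of the closed exterior that contains a neighbourhood of the frontier\<close>
  define C where "C = closure ?\<Omega> \<inter> cball 0 (B + 3)"
  have C: "compact C" unfolding C_def by (simp add: closed_Int_compact)
  have "u x + w x \<le> 2 * \<kappa>" if \<kappa>: "\<kappa> > 0" for \<kappa>
  proof -
    have ucu: "uniformly_continuous_on C u" and ucw: "uniformly_continuous_on C w"
      using u(2) w(2) continuous_on_subset[of "closure ?\<Omega>" _ C] C
      by (auto simp: C_def intro!: compact_uniformly_continuous)
    obtain d1 where d1: "d1 > 0" "\<And>p q. \<lbrakk>p \<in> C; q \<in> C; dist q p < d1\<rbrakk> \<Longrightarrow> dist (u q) (u p) < \<kappa>"
      using ucu \<kappa> unfolding uniformly_continuous_on_def by metis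
    obtain d2 where d2: "d2 > 0" "\<And>p q. \<lbrakk>p \<in> C; q \<in> C; dist q p < d2\<rbrakk> \<Longrightarrow> dist (w q) (w p) < \<kappa>"
      using ucw \<kappa> unfolding uniformly_continuous_on_def by metis
    \<comment> \<open>in the boundary layer, the points \<open>y1\<close> and \<open>y2\<close> where the suprema are attained have a common frontier point within \<open>5 * \<epsilon>\<close>\<close>
    define \<epsilon> where "\<epsilon> = min (min \<epsilon>0 1) (min d1 d2 / 6)"
    have \<epsilon>: "\<epsilon> > 0" "\<epsilon> \<le> \<epsilon>0" "\<epsilon> \<le> 1" "6 * \<epsilon> \<le> d1" "6 * \<epsilon> \<le> d2"
      using \<epsilon>0 d1(1) d2(1) by (auto simp: \<epsilon>_def min_def)
    define X where "X = {y. cball y \<epsilon> \<subseteq> ?\<Omega>}"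
    define Y where "Y = {y. cball y (2 * \<epsilon>) \<subseteq> ?\<Omega>}"
    have xX: "x \<in> X"
      unfolding X_def using subset_trans[OF subset_cball[OF \<epsilon>(2)] \<epsilon>0(2)] by simp
    have cu: "continuous_on S u" and cw: "continuous_on S w" if "S \<subseteq> ?\<Omega>" for S
      using that closure_subset[of ?\<Omega>] u(2) w(2) continuous_on_subset by blast+
    have X: "\<exists>z\<in>cball y \<epsilon>. ball_sup \<epsilon> u y = u z" "u y \<le> ball_sup \<epsilon> u y"
      "\<exists>z\<in>cball y \<epsilon>. ball_sup \<epsilon> w y = w z" "w y \<le> ball_sup \<epsilon> w y" if "y \<in> X" for y
    proof -
      have sub: "cball y \<epsilon> \<subseteq> ?\<Omega>" using that by (simp add: X_def)
      show "\<exists>z\<in>cball y \<epsilon>. ball_sup \<epsilon> u y = u z" "u y \<le> ball_sup \<epsilon> u y"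
        using ball_sup_attained[OF cu[OF sub]] \<epsilon>(1) by (metis centre_in_cball less_imp_le)+
      show "\<exists>z\<in>cball y \<epsilon>. ball_sup \<epsilon> w y = w z" "w y \<le> ball_sup \<epsilon> w y"
        using ball_sup_attained[OF cw[OF sub]] \<epsilon>(1) by (metis centre_in_cball less_imp_le)+
    qed
    have "ball_sup \<epsilon> u x + ball_sup \<epsilon> w x \<le> 2 * \<kappa>"
    proof (rule discrete_comparison[where X = X and Y = Y and \<epsilon> = \<epsilon> and a = a and M = M])
      show "\<epsilon> > 0" by (rule \<epsilon>(1))
      show "x \<in> X" by (rule xX)
      have "a \<in> cball a \<epsilon>" using \<epsilon>(1) by simp
      then show "a \<notin> X" using a unfolding X_def by blast
      show "cball y \<epsilon> \<subseteq> X" if "y \<in> Y" for y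
      proof
        fix z assume z: "z \<in> cball y \<epsilon>"
        have "cball z \<epsilon> \<subseteq> cball y (2 * \<epsilon>)"
        proof
          fix p assume "p \<in> cball z \<epsilon>"
          then show "p \<in> cball y (2 * \<epsilon>)" using z dist_triangle[of y p z] by auto
        qed
        then show "z \<in> X" using that by (auto simp: X_def Y_def)
      qed
      show "ball_sup \<epsilon> u y \<le> M" if "y \<in> X" for y
        using X(1)[OF that] that u(3) by (auto simp: X_def subset_iff)
      show "ball_sup \<epsilon> w y \<le> M" if "y \<in> X" for y
        using X(3)[OF that] that w(3) by (auto simp: X_def subset_iff)
      show "\<exists>s. (\<exists>z\<in>cball y \<epsilon>. ball_sup \<epsilon> u z = ball_sup \<epsilon> u y + s) \<and>
          (\<forall>z\<in>cball y \<epsilon>. \<bar>ball_sup \<epsilon> u z - ball_sup \<epsilon> u y\<bar> \<le> s)" if "y \<in> Y" for y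
        using that \<epsilon>(1) unfolding Y_def
        by (intro ball_sup_balanced cu viscosity_subsolution_cone_estimate[OF u(1) cu]) auto
      show "\<exists>s. (\<exists>z\<in>cball y \<epsilon>. ball_sup \<epsilon> w z = ball_sup \<epsilon> w y + s) \<and>
          (\<forall>z\<in>cball y \<epsilon>. \<bar>ball_sup \<epsilon> w z - ball_sup \<epsilon> w y\<bar> \<le> s)" if "y \<in> Y" for y
        using that \<epsilon>(1) unfolding Y_def
        by (intro ball_sup_balanced cw viscosity_subsolution_cone_estimate[OF w(1) cw]) auto
      show "ball_sup \<epsilon> u y + ball_sup \<epsilon> w y \<le> 2 * \<kappa>" if y: "y \<in> X - Y" for y
      proof -
        obtain y1 y2 where y1: "y1 \<in> cball y \<epsilon>" "ball_sup \<epsilon> u y = u y1"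
          and y2: "y2 \<in> cball y \<epsilon>" "ball_sup \<epsilon> w y = w y2"
          using X(1)[of y] X(3)[of y] y by auto
        have in\<Omega>: "y1 \<in> ?\<Omega>" "y2 \<in> ?\<Omega>" using y y1 y2 by (auto simp: X_def)
        obtain b where b: "b \<in> A" "dist y b \<le> 2 * \<epsilon>" using y by (auto simp: Y_def)
        have "closed_segment y1 b \<inter> frontier A \<noteq> {}"
          using b(1) in\<Omega>(1) by (intro connected_Int_frontier) auto
        then obtain p where p: "p \<in> closed_segment y1 b" "p \<in> frontier A" by blast
        have "dist y1 b \<le> 3 * \<epsilon>" using y1 b dist_triangle[of y1 b y] by (auto simp: dist_commute)
        moreover have "dist y1 p \<le> dist y1 b"
          using dist_in_closed_segment(1)[OF p(1)] by (simp add: dist_commute)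
        ultimately have 1: "dist y1 p \<le> 3 * \<epsilon>" by linarith
        have 2: "dist y2 p \<le> 5 * \<epsilon>"
          using 1 y1 y2 dist_triangle[of y2 p y1] dist_triangle[of y2 y1 y] by (auto simp: dist_commute)
        have pA: "p \<in> A" using p(2) A(1) by (simp add: frontier_def compact_imp_closed)
        have pcl: "p \<in> closure ?\<Omega>" using p(2) by (simp add: frontier_closures)
        have "norm z \<le> B + 3" if "dist y b \<le> 2 * \<epsilon>" "z \<in> cball y \<epsilon>" for z
        proof -
          have "dist z b \<le> 3 * \<epsilon>" using that dist_triangle[of z b y] by (auto simp: dist_commute)
          then show ?thesis
            using norm_triangle_sub[of z b] B[OF b(1)] \<epsilon>(3) by (simp add: dist_norm)
        qed
        then have mem: "y1 \<in> C" "y2 \<in> C" "p \<in> C"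
          using in\<Omega> closure_subset[of ?\<Omega>] b y1 y2 B[OF pA] pcl by (auto simp: C_def)
        have "u y1 < u p + \<kappa>"
          using d1(2)[OF mem(3,1)] 1 \<epsilon> by (auto simp: dist_real_def)
        moreover have "w y2 < w p + \<kappa>"
          using d2(2)[OF mem(3,2)] 2 \<epsilon> by (auto simp: dist_real_def)
        moreover have "u p + w p \<le> 0" using le[OF p(2)] by (simp add: w_def)
        ultimately show ?thesis using y1(2) y2(2) by linarith
      qed
    qed
    then show ?thesis using X(2,4)[OF xX] by linarith
  qed
  then have "u x + w x \<le> 0 + \<kappa>" if "\<kappa> > 0" for \<kappa>
    using that by (metis add_0 half_gt_zero field_sum_of_halves mult_2)
  then have "u x + w x \<le> 0" by (rule field_le_epsilon)
  then show ?thesis by (simp add: w_def)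
qed

section \<open>Existence and uniqueness in exterior domains\<close>

text \<open>With \<open>m\<close> and \<open>M\<close> the extreme values of \<open>g - \<psi>\<close> on the frontier, the bounds
  \<open>\<psi> + m \<le> u \<le> \<psi> + M\<close> say that \<open>u - \<psi>\<close> has its extrema there.\<close>

lemma exterior_existence:
  fixes A :: "(real ^ 'n) set" and g \<psi> :: "real ^ 'n \<Rightarrow> real"
  assumes A: "compact A" "A \<noteq> {}" and g: "continuous_on (frontier (- A)) g"
    and \<psi>: "\<And>V. \<lbrakk>open V; bounded V; closure V \<subseteq> - A\<rbrakk> \<Longrightarrow> steep_on V L \<psi>"
  shows "\<exists>u. dirichlet_solution (- A) g u \<and> extrema_on_frontier (- A) (\<lambda>x. u x - \<psi> x)"
proof -
  let ?\<Omega> = "- A"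
  have op: "open ?\<Omega>" using A(1) by (simp add: compact_imp_closed open_Compl)
  have fr: "compact (frontier ?\<Omega>)" "frontier ?\<Omega> \<noteq> {}"
  proof -
    show "compact (frontier ?\<Omega>)" using A(1) by (simp add: compact_frontier)
    have "A \<noteq> UNIV" using compact_imp_bounded[OF A(1)] not_bounded_UNIV by auto
    then show "frontier ?\<Omega> \<noteq> {}" using A(2) by (simp add: frontier_eq_empty)
  qed
  have "continuous_on (frontier ?\<Omega>) \<psi>" using steep_on_lipschitz(3)[OF \<psi>[of "{}"]] by simp
  with g have cont: "continuous_on (frontier ?\<Omega>) (\<lambda>x. g x - \<psi> x)" by (rule continuous_on_diff)
  obtain y1 where y1: "y1 \<in> frontier ?\<Omega>" "\<And>y. y \<in> frontier ?\<Omega> \<Longrightarrow> g y1 - \<psi> y1 \<le> g y - \<psi> y"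
    using continuous_attains_inf[OF fr cont] by blast
  obtain y2 where y2: "y2 \<in> frontier ?\<Omega>" "\<And>y. y \<in> frontier ?\<Omega> \<Longrightarrow> g y - \<psi> y \<le> g y2 - \<psi> y2"
    using continuous_attains_sup[OF fr cont] by blast
  obtain u where u: "comparison_cones_above ?\<Omega> u" "comparison_cones_below ?\<Omega> u"
    "continuous_on (closure ?\<Omega>) u" "\<And>y. y \<in> frontier ?\<Omega> \<Longrightarrow> u y = g y"
    "\<And>x. x \<in> closure ?\<Omega> \<Longrightarrow> \<psi> x + (g y1 - \<psi> y1) \<le> u x"
    "\<And>x. x \<in> closure ?\<Omega> \<Longrightarrow> u x \<le> \<psi> x + (g y2 - \<psi> y2)"
  proof (rule cone_dirichlet_problem[OF op fr g \<psi>])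
    show "\<psi> y + (g y1 - \<psi> y1) \<le> g y" if "y \<in> frontier ?\<Omega>" for y using y1(2)[OF that] by simp
    show "g y \<le> \<psi> y + (g y2 - \<psi> y2)" if "y \<in> frontier ?\<Omega>" for y using y2(2)[OF that] by simp
  qed auto
  have "infinity_harmonic_on ?\<Omega> u"
    by (rule comparison_imp_infinity_harmonic[OF op u(1,2) continuous_on_subset[OF u(3) closure_subset]])
  then have "dirichlet_solution ?\<Omega> g u" using u(3,4) by (simp add: dirichlet_solution_def)
  moreover have "extrema_on_frontier ?\<Omega> (\<lambda>x. u x - \<psi> x)"
    unfolding extrema_on_frontier_def
  proof (intro conjI)
    show "\<exists>y\<in>frontier ?\<Omega>. \<forall>x\<in>closure ?\<Omega>. u x - \<psi> x \<le> u y - \<psi> y"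
      using u(4)[OF y2(1)] u(6) by (intro bexI[OF _ y2(1)] ballI) (simp add: diff_le_eq add.commute)
    show "\<exists>y\<in>frontier ?\<Omega>. \<forall>x\<in>closure ?\<Omega>. u y - \<psi> y \<le> u x - \<psi> x"
      using u(4)[OF y1(1)] u(5) by (intro bexI[OF _ y1(1)] ballI) (simp add: le_diff_eq add.commute)
  qed
  ultimately show ?thesis by blast
qed

text \<open>Having its extrema on the frontier makes a solution bounded, which is the growth
  condition under which comparison holds in an exterior domain.\<close>

lemma bounded_dirichlet_solution_le:
  fixes A :: "(real ^ 'n) set"
  assumes A: "compact A" "A \<noteq> {}"
    and u: "dirichlet_solution (- A) g u" "extrema_on_frontier (- A) u"
    and v: "dirichlet_solution (- A) g v" "extrema_on_frontier (- A) v"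
    and x: "x \<in> closure (- A)"
  shows "u x \<le> v x"
proof (cases "x \<in> - A")
  case True
  obtain y where y: "\<And>x. x \<in> closure (- A) \<Longrightarrow> u x \<le> u y"
    using u(2) unfolding extrema_on_frontier_def by blast
  obtain z where z: "\<And>x. x \<in> closure (- A) \<Longrightarrow> v z \<le> v x"
    using v(2) unfolding extrema_on_frontier_def by blast
  have cl: "p \<in> closure (- A)" if "p \<in> - A" for p using that closure_subset by blast
  show ?thesis
  proof (rule exterior_comparison[OF A, where M = "max (u y) (- v z)"])
    show "u p \<le> max (u y) (- v z)" if "p \<in> - A" for p using y[OF cl[OF that]] by simp
    show "- max (u y) (- v z) \<le> v p" if "p \<in> - A" for p using z[OF cl[OF that]] by linarith
    show "u p \<le> v p" if "p \<in> frontier A" for p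
      using u(1) v(1) that by (simp add: dirichlet_solution_def)
  qed (use u(1) v(1) True in \<open>auto simp: dirichlet_solution_def infinity_harmonic_on_def\<close>)
next
  case False
  then have "x \<in> frontier (- A)"
    using x A(1) by (simp add: frontier_def interior_open compact_imp_closed open_Compl)
  then show ?thesis using u(1) v(1) by (simp add: dirichlet_solution_def)
qed

theorem theorem2:
  fixes A \<Omega> :: "(real ^ 'n) set" and g :: "real ^ 'n \<Rightarrow> real"
  assumes "bounded A" and "closed A" and "0 \<in> A" and "A \<subseteq> ball 0 1"
    and "\<Omega> = UNIV - A"
    and "continuous_on (frontier \<Omega>) g"
  shows "(\<forall>c::real. \<exists>u. dirichlet_solution \<Omega> g u \<and>
              extrema_on_frontier \<Omega> (\<lambda>x. u x - c * norm x)) \<and>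
         (\<forall>u v. dirichlet_solution \<Omega> g u \<and> extrema_on_frontier \<Omega> (\<lambda>x. u x - 0 * norm x) \<and>
                dirichlet_solution \<Omega> g v \<and> extrema_on_frontier \<Omega> (\<lambda>x. v x - 0 * norm x) \<longrightarrow>
              (\<forall>x\<in>closure \<Omega>. u x = v x)) \<and>
         (\<forall>a::real ^ 'n. norm a > 0 \<longrightarrow>
              (\<exists>u. dirichlet_solution \<Omega> g u \<and>
                   extrema_on_frontier \<Omega> (\<lambda>x. u x - a \<bullet> x)))"
proof (intro conjI allI impI ballI)
  have A: "compact A" "A \<noteq> {}" using assms(1-3) by (auto simp: compact_eq_bounded_closed)
  have \<Omega>: "\<Omega> = - A" using assms(5) by auto
  have g: "continuous_on (frontier (- A)) g" using assms(6) by (simp only: \<Omega>)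
  show "\<exists>u. dirichlet_solution \<Omega> g u \<and> extrema_on_frontier \<Omega> (\<lambda>x. u x - c * norm x)" for c
    unfolding \<Omega>
  proof (rule exterior_existence[OF A g, where L = "\<bar>c\<bar>"])
    fix V :: "(real ^ 'n) set" assume V: "open V" "bounded V" "closure V \<subseteq> - A"
    have "0 \<notin> V" using V(3) assms(3) closure_subset by auto
    then show "steep_on V \<bar>c\<bar> (\<lambda>x. c * norm x)"
      using cone_steep[OF V(1,2), of 0 c 0] by simp
  qed
  show "\<exists>u. dirichlet_solution \<Omega> g u \<and> extrema_on_frontier \<Omega> (\<lambda>x. u x - a \<bullet> x)"
    if "norm a > 0" for a
    unfolding \<Omega>
    by (rule exterior_existence[OF A g linear_steep]) (use that in auto)
  show "u x = v x"
    if "dirichlet_solution \<Omega> g u \<and> extrema_on_frontier \<Omega> (\<lambda>x. u x - 0 * norm x) \<and>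
        dirichlet_solution \<Omega> g v \<and> extrema_on_frontier \<Omega> (\<lambda>x. v x - 0 * norm x)"
      and "x \<in> closure \<Omega>" for u v x
    using that bounded_dirichlet_solution_le[OF A, of g u v x]
      bounded_dirichlet_solution_le[OF A, of g v u x] unfolding \<Omega> by simp
qed

end
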